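(* For every $n\ge1$, the labeling $\lambda_\bullet$ is an EW-labeling of $\Pi_n^\bullet$. As a consequence, $\Pi_n^\bullet$ has a Whitney dual.
   Context: A pointed set is a pair $(A,p)$, written $A^p$, with $A$ nonempty finite and $p\in A$. A pointed partition of $[n]$ is a collection of pointed sets whose underlying sets form a set partition of $[n]$. In $\Pi_n^\bullet$, $\pi\lessdot\pi'$ exactly when $\pi'$ is obtained from $\pi$ by replacing two blocks $A^p,B^q$ (with $\min A<\min B$) by $(A\cup B)^p$ (a $1$-merge) or $(A\cup B)^q$ (a $0$-merge), other blocks unchanged; its minimum is the partition into singletons. The labeling $\lambda_\bullet$ assigns to a $u$-merge the label $(\min A,\min B)^u$, valued in the poset $\Lambda_n^\bullet$ whose elements are $(a,b)^u$ with $1\le a<b\le n$, $u\in\{0,1\}$, ordered as the ordinal sum $A_1\oplus C_1\oplus\cdots\oplus A_{n-1}\oplus C_{n-1}$, where $A_a$ is the antichain $\{(a,b)^0:a<b\le n\}$ and $C_a$ is the chain $\{(a,b)^1\}$ with $(a,b)^1<(a,c)^1$ iff $b<c$. For an edge labeling $\lambda$ of a poset $P$: a saturated chain is increasing if its consecutive labels strictly increase, ascent-free if no two consecutive labels satisfy $\lambda_i<\lambda_{i+1}$. $\lambda$ is an EW-labeling if (1) every interval has a unique increasing maximal chain (ER-labeling); (2) for every interval $[x,y]$ of rank 2 whose increasing chain has label sequence $ab$, there is exactly one maximal chain of $[x,y]$ with label sequence $ba$; (3) for all $x<y$, distinct ascent-free maximal chains of $[x,y]$ have distinct label sequences. For a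 graded poset with $\hat0$, $w_k(P)=\sum_{\rho(x)=k}\mu(\hat0,x)$ and $W_k(P)=\#\{x:\rho(x)=k\}$; $P$ and $Q$ are Whitney duals if $|w_k(P)|=W_k(Q)$ and $|w_k(Q)|=W_k(P)$ for all $k$. *)

theory Defs
  imports Main "HOL-Library.Disjoint_Sets"
begin

section \<open>Posets\<close>

text \<open>
  A poset is a reflexive, antisymmetric, transitive relation \<open>P\<close>
  (\<open>Partial_order P\<close>) on its carrier \<open>Field P\<close>; \<open>(x, y) \<in> P\<close> is read as
  \<open>x \<le> y\<close>.
\<close>

definition less_in :: "'a rel \<Rightarrow> 'a \<Rightarrow> 'a \<Rightarrow> bool" where
  "less_in P x y \<longleftrightarrow> (x, y) \<in> P \<and> x \<noteq> y"

definition covers :: "'a rel \<Rightarrow> 'a \<Rightarrow> 'a \<Rightarrow> bool" where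
  "covers P x y \<longleftrightarrow> less_in P x y \<and> \<not> (\<exists>z. less_in P x z \<and> less_in P z y)"

definition is_bottom :: "'a rel \<Rightarrow> 'a \<Rightarrow> bool" where
  "is_bottom P z \<longleftrightarrow> z \<in> Field P \<and> (\<forall>x\<in>Field P. (z, x) \<in> P)"

definition bottom :: "'a rel \<Rightarrow> 'a" where
  "bottom P = (THE z. is_bottom P z)"

definition is_rank_function :: "'a rel \<Rightarrow> ('a \<Rightarrow> nat) \<Rightarrow> bool" where
  "is_rank_function P r \<longleftrightarrow>
     r (bottom P) = 0 \<and> (\<forall>x y. covers P x y \<longrightarrow> r y = Suc (r x))"

definition graded_poset :: "'a rel \<Rightarrow> bool" where
  "graded_poset P \<longleftrightarrow>
     finite P \<and> Partial_order P \<and> (\<exists>z. is_bottom P z) \<and> (\<exists>r. is_rank_function P r)"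

text \<open>On a graded poset, all rank functions agree on the carrier.\<close>

definition rank :: "'a rel \<Rightarrow> 'a \<Rightarrow> nat" where
  "rank P = (SOME r. is_rank_function P r)"

text \<open>
  The usual recursion \<open>\<mu>(x,x) = 1\<close> and \<open>\<mu>(x,y) = - (\<Sum>x \<le> z < y. \<mu>(x,z))\<close>.  The guard
  makes the recursion terminate; it is met by every interval of a finite poset.
\<close>

function moebius :: "'a rel \<Rightarrow> 'a \<Rightarrow> 'a \<Rightarrow> int" where
  "moebius P x y =
     (if finite P \<and> Partial_order P \<and> (x, y) \<in> P
      then (if x = y then 1
            else - (\<Sum>z\<in>{z. (x, z) \<in> P \<and> less_in P z y}. moebius P x z))
      else 0)"
  by pat_completeness auto
termination
proof (relation "measure (\<lambda>(P, x, y). card {z. (z, y) \<in> P})", simp)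
  fix P :: "'a rel" and x y z
  assume P: "finite P \<and> Partial_order P \<and> (x, y) \<in> P"
    and z: "z \<in> {z. (x, z) \<in> P \<and> less_in P z y}"
  have tr: "trans P" and an: "antisym P" and rf: "refl_on (Field P) P"
    using P by (auto simp: order_on_defs)
  have zy: "(z, y) \<in> P" "z \<noteq> y" using z by (auto simp: less_in_def)
  have "{w. (w, y) \<in> P} \<subseteq> fst ` P" by force
  then have fin: "finite {w. (w, y) \<in> P}" using P by (meson finite_imageI finite_subset)
  have "y \<in> Field P" using zy by (auto simp: Field_def)
  then have "(y, y) \<in> P" using rf by (auto simp: refl_on_def)
  moreover have "(y, z) \<notin> P" using an zy by (auto dest: antisymD)
  moreover have "{w. (w, z) \<in> P} \<subseteq> {w. (w, y) \<in> P}" using tr zy by (auto dest: transD)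
  ultimately have "{w. (w, z) \<in> P} \<subset> {w. (w, y) \<in> P}" by blast
  then have "card {w. (w, z) \<in> P} < card {w. (w, y) \<in> P}"
    by (rule psubset_card_mono[OF fin])
  then show "((P, x, z), (P, x, y)) \<in> measure (\<lambda>(P, x, y). card {z. (z, y) \<in> P})" by simp
qed

declare moebius.simps [simp del]

definition whitney_first :: "'a rel \<Rightarrow> nat \<Rightarrow> int" where
  "whitney_first P k = (\<Sum>x\<in>{x \<in> Field P. rank P x = k}. moebius P (bottom P) x)"

definition whitney_second :: "'a rel \<Rightarrow> nat \<Rightarrow> nat" where
  "whitney_second P k = card {x \<in> Field P. rank P x = k}"

definition whitney_duals :: "'a rel \<Rightarrow> 'b rel \<Rightarrow> bool" where
  "whitney_duals P Q \<longleftrightarrow>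
     graded_poset P \<and> graded_poset Q \<and>
     (\<forall>k. \<bar>whitney_first P k\<bar> = int (whitney_second Q k) \<and>
          \<bar>whitney_first Q k\<bar> = int (whitney_second P k))"

text \<open>
  Graded posets are finite here, so every candidate dual is isomorphic to one whose
  elements are natural numbers.
\<close>

definition has_whitney_dual :: "'a rel \<Rightarrow> bool" where
  "has_whitney_dual P \<longleftrightarrow> (\<exists>Q :: nat rel. whitney_duals P Q)"


section \<open>Edge labelings\<close>

text \<open>
  An edge labeling of \<open>P\<close> with values in the poset \<open>L\<close> is a function \<open>lab\<close> of which only the
  values \<open>lab x y\<close> at cover relations of \<open>P\<close> matter.
\<close>

definition edge_labeling :: "'a rel \<Rightarrow> 'l rel \<Rightarrow> ('a \<Rightarrow> 'a \<Rightarrow> 'l) \<Rightarrow> bool" where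
  "edge_labeling P L lab \<longleftrightarrow>
     graded_poset P \<and> Partial_order L \<and> (\<forall>x y. covers P x y \<longrightarrow> lab x y \<in> Field L)"

text \<open>In a finite poset, the maximal chains of \<open>[x, y]\<close> are the saturated chains from \<open>x\<close> to \<open>y\<close>.\<close>

definition max_chains :: "'a rel \<Rightarrow> 'a \<Rightarrow> 'a \<Rightarrow> 'a list set" where
  "max_chains P x y =
     {c. c \<noteq> [] \<and> set c \<subseteq> Field P \<and> hd c = x \<and> last c = y \<and> successively (covers P) c}"

definition labels :: "('a \<Rightarrow> 'a \<Rightarrow> 'l) \<Rightarrow> 'a list \<Rightarrow> 'l list" where
  "labels lab c = map2 lab c (tl c)"

definition increasing_chain :: "'l rel \<Rightarrow> ('a \<Rightarrow> 'a \<Rightarrow> 'l) \<Rightarrow> 'a list \<Rightarrow> bool" where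
  "increasing_chain L lab c \<longleftrightarrow> successively (less_in L) (labels lab c)"

definition ascent_free_chain :: "'l rel \<Rightarrow> ('a \<Rightarrow> 'a \<Rightarrow> 'l) \<Rightarrow> 'a list \<Rightarrow> bool" where
  "ascent_free_chain L lab c \<longleftrightarrow> successively (\<lambda>a b. \<not> less_in L a b) (labels lab c)"

definition ER_labeling :: "'a rel \<Rightarrow> 'l rel \<Rightarrow> ('a \<Rightarrow> 'a \<Rightarrow> 'l) \<Rightarrow> bool" where
  "ER_labeling P L lab \<longleftrightarrow>
     edge_labeling P L lab \<and>
     (\<forall>x y. (x, y) \<in> P \<longrightarrow> (\<exists>!c. c \<in> max_chains P x y \<and> increasing_chain L lab c))"

definition rank_two_switching :: "'a rel \<Rightarrow> 'l rel \<Rightarrow> ('a \<Rightarrow> 'a \<Rightarrow> 'l) \<Rightarrow> bool" where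
  "rank_two_switching P L lab \<longleftrightarrow>
     (\<forall>x y c a b.
        (x, y) \<in> P \<and> rank P y = rank P x + 2 \<and>
        c \<in> max_chains P x y \<and> increasing_chain L lab c \<and> labels lab c = [a, b] \<longrightarrow>
        (\<exists>!d. d \<in> max_chains P x y \<and> labels lab d = [b, a]))"

definition ascent_free_injective :: "'a rel \<Rightarrow> 'l rel \<Rightarrow> ('a \<Rightarrow> 'a \<Rightarrow> 'l) \<Rightarrow> bool" where
  "ascent_free_injective P L lab \<longleftrightarrow>
     (\<forall>x y. less_in P x y \<longrightarrow>
        inj_on (labels lab) {c \<in> max_chains P x y. ascent_free_chain L lab c})"

definition EW_labeling :: "'a rel \<Rightarrow> 'l rel \<Rightarrow> ('a \<Rightarrow> 'a \<Rightarrow> 'l) \<Rightarrow> bool" where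
  "EW_labeling P L lab \<longleftrightarrow>
     ER_labeling P L lab \<and> rank_two_switching P L lab \<and> ascent_free_injective P L lab"


section \<open>Pointed partitions\<close>

text \<open>The pair \<open>(A, p)\<close> stands for the pointed set \<open>A\<^sup>p\<close>.\<close>

type_synonym pointed = "nat set \<times> nat"

text \<open>Injectivity of \<open>fst\<close> says that each underlying set occurs with a single point.\<close>

definition pointed_partition :: "nat \<Rightarrow> pointed set \<Rightarrow> bool" where
  "pointed_partition n \<pi> \<longleftrightarrow>
     (\<forall>(A, p)\<in>\<pi>. p \<in> A) \<and> inj_on fst \<pi> \<and> partition_on {1..n} (fst ` \<pi>)"

text \<open>A label \<open>(a, b)\<^sup>u\<close> is the triple \<open>(a, b, u)\<close>, with \<open>u \<in> {0, 1}\<close>.\<close>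

type_synonym label = "nat \<times> nat \<times> nat"

text \<open>
  \<open>merge_at u A p B q \<pi> \<pi>'\<close>: \<open>\<pi>'\<close> arises from \<open>\<pi>\<close> by the \<open>u\<close>-merge of the blocks
  \<open>A\<^sup>p\<close> and \<open>B\<^sup>q\<close>, where \<open>min A < min B\<close>.
\<close>

definition merge_at ::
  "nat \<Rightarrow> nat set \<Rightarrow> nat \<Rightarrow> nat set \<Rightarrow> nat \<Rightarrow> pointed set \<Rightarrow> pointed set \<Rightarrow> bool" where
  "merge_at u A p B q \<pi> \<pi>' \<longleftrightarrow>
     (A, p) \<in> \<pi> \<and> (B, q) \<in> \<pi> \<and> Min A < Min B \<and> u \<in> {0, 1} \<and>
     \<pi>' = insert (A \<union> B, if u = 1 then p else q) (\<pi> - {(A, p), (B, q)})"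

definition merges :: "nat \<Rightarrow> pointed set rel" where
  "merges n =
     {(\<pi>, \<pi>'). pointed_partition n \<pi> \<and> pointed_partition n \<pi>' \<and>
               (\<exists>u A p B q. merge_at u A p B q \<pi> \<pi>')}"

definition pointed_partition_poset :: "nat \<Rightarrow> pointed set rel" where
  "pointed_partition_poset n =
     {(\<pi>, \<pi>'). pointed_partition n \<pi> \<and> (\<pi>, \<pi>') \<in> (merges n)\<^sup>*}"

definition lambda_bullet :: "pointed set \<Rightarrow> pointed set \<Rightarrow> label" where
  "lambda_bullet \<pi> \<pi>' =
     (THE l. \<exists>u A p B q. merge_at u A p B q \<pi> \<pi>' \<and> l = (Min A, Min B, u))"


section \<open>The poset of labels\<close>

definition label_antichain :: "nat \<Rightarrow> nat \<Rightarrow> label rel" where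
  "label_antichain n a = {((a, b, 0), (a, b, 0)) | b. a < b \<and> b \<le> n}"

definition label_chain :: "nat \<Rightarrow> nat \<Rightarrow> label rel" where
  "label_chain n a = {((a, b, 1), (a, c, 1)) | b c. a < b \<and> b \<le> c \<and> c \<le> n}"

definition ordinal_sum :: "'a rel \<Rightarrow> 'a rel \<Rightarrow> 'a rel" where
  "ordinal_sum R S = R \<union> S \<union> Field R \<times> Field S"

text \<open>The ordinal sum \<open>A\<^sub>1 \<oplus> C\<^sub>1 \<oplus> \<dots> \<oplus> A\<^sub>n\<^sub>-\<^sub>1 \<oplus> C\<^sub>n\<^sub>-\<^sub>1\<close>, empty if \<open>n = 1\<close>.\<close>

definition label_poset :: "nat \<Rightarrow> label rel" where
  "label_poset n =
     foldr ordinal_sum (concat (map (\<lambda>a. [label_antichain n a, label_chain n a]) [1..<n])) {}"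

end

theory Submission
  imports Defs
begin

text \<open>
  A label together with the partition it is applied to determines the merge, so a saturated chain is
  determined by its start and its labels; and merges whose labels ascend can be interchanged.
  What remains for the EW property is the increasing chain: its first label is forced, and forced
  labels increase.

  A Whitney dual is the poset of rooted forests on \<open>{1..n}\<close>, ordered
    by hanging roots below roots.
  Its intervals from the bottom are distributive lattices, so its Moebius function is \<open>\<plusminus> 1\<close> at the
  star forests (forests of height at most one), which are pointed partitions in disguise,
    and \<open>0\<close>
  elsewhere.  Conversely, the trees of a forest pointed at their roots form a pointed partition, and
  up to sign the Moebius function of a pointed partition counts the forests that induce it.
\<close>

section \<open>Finite posets\<close>

text \<open>Two obstacles shape the proof. The order is a transitive closure of merges, which says
  little about what lies inside an interval. \<open>pointed_refines\<close> replaces it by a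
  blockwise condition, and a single greedy merge towards \<open>y\<close>
  (\<open>ex_canonical_merge\<close>) yields the equivalence of the two, the cover relation and the
  increasing chain. Uniqueness of that chain is read from its end: the last label is canonical for
  its step, and \<open>canonical_label_extend\<close> carries the property back across each ascent.
  The order on labels makes this work: for equal \<open>a\<close> an ascent must end in a
  \<open>1\<close>-merge, so the point of the block under construction is settled by its first
  merge.

  The Moebius functions are guessed and then checked against the defining recursion. In both cases
  the recursion becomes a signed sum over sets of edges, which cancels by toggling one edge.\<close>

lemma Partial_orderD:
  assumes "Partial_order P"
  shows "x \<in> Field P \<Longrightarrow> (x, x) \<in> P"
    and "(x, y) \<in> P \<Longrightarrow> (y, z) \<in> P \<Longrightarrow> (x, z) \<in> P"
    and "(x, y) \<in> P \<Longrightarrow> (y, x) \<in> P \<Longrightarrow> x = y"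
  using assms by (auto simp: order_on_defs refl_on_def dest: transD antisymD)

lemma Partial_orderI:
  assumes "\<And>x y. (x, y) \<in> P \<Longrightarrow> (x, x) \<in> P \<and> (y, y) \<in> P"
    and "\<And>x y z. (x, y) \<in> P \<Longrightarrow> (y, z) \<in> P \<Longrightarrow> (x, z) \<in> P"
    and "\<And>x y. (x, y) \<in> P \<Longrightarrow> (y, x) \<in> P \<Longrightarrow> x = y"
  shows "Partial_order P"
  unfolding order_on_defs
proof (intro conjI)
  show "refl_on (Field P) P" using assms(1) by (auto simp: refl_on_def Field_def)
  show "trans P" using assms(2) by (rule transI)
  show "antisym P" using assms(3) by (rule antisymI)
qed (auto simp: Field_def)

lemma bottom_eqI:
  assumes "Partial_order P" "is_bottom P z"
  shows "bottom P = z"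
  unfolding bottom_def
proof (rule the_equality)
  show "w = z" if "is_bottom P w" for w
    using assms that by (auto simp: is_bottom_def dest: Partial_orderD(3)[OF assms(1)])
qed (rule assms)

lemma finite_lower_set:
  fixes P :: "'a rel"
  assumes "finite P"
  shows "finite {w. (w, x) \<in> P}"
  by (rule finite_subset[of _ "Field P"]) (use assms in \<open>auto simp: finite_Field FieldI1\<close>)

text \<open>The size of the principal ideal is a strictly monotone height; it is the measure for the
  inductions over elements of a finite poset.\<close>

lemma card_lower_set_less:
  assumes "finite P" "Partial_order P" "less_in P w x"
  shows "card {v. (v, w) \<in> P} < card {v. (v, x) \<in> P}"
proof (rule psubset_card_mono[OF finite_lower_set[OF assms(1)]])
  note PO = Partial_orderD[OF assms(2)]
  have w: "(w, x) \<in> P" "w \<noteq> x" using assms(3) by (auto simp: less_in_def)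
  have "(x, x) \<in> P" using w PO(1) by (auto simp: Field_def)
  moreover have "(x, w) \<notin> P" using w PO(3) by blast
  moreover have "{v. (v, w) \<in> P} \<subseteq> {v. (v, x) \<in> P}" using w PO(2) by blast
  ultimately show "{v. (v, w) \<in> P} \<subset> {v. (v, x) \<in> P}" by blast
qed

text \<open>An element of \<open>[z, x)\<close> with largest principal ideal leaves no room between
  itself and \<open>x\<close>.\<close>

lemma exists_cover_below:
  assumes "finite P" "Partial_order P" "less_in P z x"
  obtains w where "(z, w) \<in> P" "covers P w x"
proof -
  note PO = Partial_orderD[OF assms(2)]
  let ?S = "{w. (z, w) \<in> P \<and> less_in P w x}"
  let ?f = "\<lambda>w. card {v. (v, w) \<in> P}"
  have "finite ?S"
    by (rule finite_subset[OF _ finite_lower_set[OF assms(1), of x]]) (auto simp: less_in_def)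
  moreover have "z \<in> ?S" using assms(3) PO(1)[of z] by (auto simp: less_in_def Field_def)
  ultimately have fin: "finite (?f ` ?S)" and "?f ` ?S \<noteq> {}" by blast+
  then have "Max (?f ` ?S) \<in> ?f ` ?S" by (rule Max_in)
  then obtain w where w: "w \<in> ?S" and "?f w = Max (?f ` ?S)" by force
  then have max: "\<forall>v\<in>?S. ?f v \<le> ?f w" using fin by simp
  have "\<not> less_in P v x" if "less_in P w v" for v
  proof
    assume "less_in P v x"
    moreover have "(z, v) \<in> P" using w that PO(2)[of z w v] by (simp add: less_in_def)
    ultimately have "v \<in> ?S" by simp
    then show False using max card_lower_set_less[OF assms(1,2) that] by fastforce
  qed
  then show thesis using w that by (auto simp: covers_def)
qed

text \<open>\<open>rank\<close> is a Hilbert choice, so uniqueness is what lets an explicit rank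
  function compute it. A non-bottom element has a lower cover, which forces its value.\<close>

lemma rank_function_unique:
  assumes "finite P" "Partial_order P" "is_bottom P z"
    and "is_rank_function P f" "is_rank_function P g" "x \<in> Field P"
  shows "f x = g x"
  using assms(6)
proof (induction "card {v. (v, x) \<in> P}" arbitrary: x rule: less_induct)
  case less
  have z: "bottom P = z" using assms(2,3) by (rule bottom_eqI)
  show ?case
  proof (cases "x = z")
    case True
    then show ?thesis using assms(4,5) z by (auto simp: is_rank_function_def)
  next
    case False
    then have "less_in P z x" using less.prems assms(3) by (auto simp: less_in_def is_bottom_def)
    then obtain w where w: "covers P w x" using exists_cover_below[OF assms(1,2)] by blast
    then have l: "less_in P w x" by (auto simp: covers_def)
    then have "w \<in> Field P" by (auto simp: less_in_def Field_def)
    then have "f w = g w" using less.hyps card_lower_set_less[OF assms(1,2) l] by blast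
    then show ?thesis using w assms(4,5) by (auto simp: is_rank_function_def)
  qed
qed

lemma rank_eqI:
  assumes "finite P" "Partial_order P" "is_bottom P z" "is_rank_function P f" "x \<in> Field P"
  shows "rank P x = f x"
proof -
  have "is_rank_function P (rank P)" unfolding rank_def by (rule someI[of _ f]) (rule assms)
  then show ?thesis by (rule rank_function_unique[OF assms(1-3) _ assms(4,5)])
qed

lemma sum_moebius_eq_0:
  assumes "finite P" "Partial_order P" "is_bottom P z" "x \<in> Field P" "x \<noteq> z"
  shows "(\<Sum>w\<in>{w. (w, x) \<in> P}. moebius P z w) = 0"
proof -
  let ?S = "{w. (z, w) \<in> P \<and> less_in P w x}"
  have zx: "(z, x) \<in> P" using assms by (auto simp: is_bottom_def)
  have S: "{w. (w, x) \<in> P} = insert x ?S"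
    using assms Partial_orderD(1)[OF assms(2)] by (auto simp: is_bottom_def less_in_def Field_def)
  have "finite ?S" using finite_lower_set[OF assms(1), of x] unfolding S by simp
  moreover have "x \<notin> ?S" by (auto simp: less_in_def)
  moreover have "moebius P z x = - (\<Sum>w\<in>?S. moebius P z w)"
    using assms zx by (subst moebius.simps) auto
  ultimately show ?thesis unfolding S by simp
qed

text \<open>The recursion has only one solution. A conjectured formula is thus verified by showing
  that its sum over each nontrivial lower set vanishes.\<close>

lemma moebius_eqI:
  assumes "finite P" "Partial_order P" "is_bottom P z" "f z = 1"
    and sum0: "\<And>x. x \<in> Field P \<Longrightarrow> x \<noteq> z \<Longrightarrow> (\<Sum>w\<in>{w. (w, x) \<in> P}. f w) = 0"
    and "x \<in> Field P"
  shows "moebius P z x = f x"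
  using assms(6)
proof (induction "card {v. (v, x) \<in> P}" arbitrary: x rule: less_induct)
  case less
  have zx: "(z, x) \<in> P" using less.prems assms by (auto simp: is_bottom_def)
  show ?case
  proof (cases "x = z")
    case True
    then show ?thesis using zx assms by (subst moebius.simps) auto
  next
    case False
    let ?S = "{w. less_in P w x}"
    have S: "{w. (w, x) \<in> P} = insert x ?S"
      using less.prems Partial_orderD(1)[OF assms(2)] by (auto simp: less_in_def)
    have "finite ?S" using finite_lower_set[OF assms(1), of x] unfolding S by simp
    moreover have "x \<notin> ?S" by (auto simp: less_in_def)
    moreover have "(\<Sum>w\<in>?S. moebius P z w) = (\<Sum>w\<in>?S. f w)"
    proof (rule sum.cong[OF refl])
      fix w assume "w \<in> ?S"
      then show "moebius P z w = f w"
        using less.hyps[of w] card_lower_set_less[OF assms(1,2)] by (auto simp: less_in_def Field_def)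
    qed
    ultimately show ?thesis
      using sum_moebius_eq_0[OF assms(1-3) less.prems False] sum0[OF less.prems False]
      unfolding S by simp
  qed
qed

section \<open>Transport of a graded poset to the natural numbers\<close>

lemma in_dir_image_iff:
  assumes "inj_on e (Field Q)" "x \<in> Field Q" "y \<in> Field Q"
  shows "(e x, e y) \<in> dir_image Q e \<longleftrightarrow> (x, y) \<in> Q"
proof
  assume "(e x, e y) \<in> dir_image Q e"
  then obtain v w where vw: "(v, w) \<in> Q" "e x = e v" "e y = e w" by (auto simp: dir_image_def)
  then have "v \<in> Field Q" "w \<in> Field Q" by (auto simp: Field_def)
  then show "(x, y) \<in> Q" using vw assms by (metis inj_onD)
qed (auto simp: dir_image_def)

text \<open>Lets the dual live on any type: its finite carrier is injected into \<open>nat\<close>,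
  and the uniqueness of rank functions and of solutions of the Moebius recursion shows that both
  invariants survive the transport.\<close>

lemma has_whitney_dualI:
  fixes Q :: "'b rel"
  assumes "whitney_duals P Q"
  shows "has_whitney_dual P"
proof -
  have gQ: "graded_poset Q" and gP: "graded_poset P" using assms by (auto simp: whitney_duals_def)
  then obtain z f where Q: "finite Q" "Partial_order Q" "is_bottom Q z" "is_rank_function Q f"
    by (auto simp: graded_poset_def)
  have "finite (Field Q)" using Q(1) by (rule finite_Field)
  then obtain e :: "'b \<Rightarrow> nat" where e: "inj_on e (Field Q)"
    using finite_imp_inj_to_nat_seg by blast
  let ?R = "dir_image Q e"
  let ?d = "inv_into (Field Q) e"
  have d: "?d (e x) = x" if "x \<in> Field Q" for x using e that by simp
  have FR: "Field ?R = e ` Field Q" by (rule dir_image_Field)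
  note R_iff = in_dir_image_iff[OF e]
  have "?R = map_prod e e ` Q" by (auto simp: dir_image_def)
  then have finR: "finite ?R" using Q(1) by simp
  have poR: "Partial_order ?R" using Q(2) e by (rule Partial_order_dir_image)
  have z: "z \<in> Field Q"
    and zQ: "\<And>x. x \<in> Field Q \<Longrightarrow> (z, x) \<in> Q" using Q(3) by (auto simp: is_bottom_def)
  have botR: "is_bottom ?R (e z)" using z zQ R_iff by (auto simp: is_bottom_def FR)
  have lessR: "less_in ?R (e x) (e y) \<longleftrightarrow> less_in Q x y" if "x \<in> Field Q" "y \<in> Field Q" for x y
    using that R_iff[OF that] inj_on_eq_iff[OF e that] by (simp add: less_in_def)
  \<comment> \<open>Covers of the image come from covers of \<open>Q\<close>; hence the rank of
    \<open>Q\<close>, pulled back along the inverse \<open>?d\<close>, is a rank function of the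
    image.\<close>
  have coversR: "covers Q x y" if xy: "x \<in> Field Q" "y \<in> Field Q"
    and c: "covers ?R (e x) (e y)" for x y
    unfolding covers_def
  proof (intro conjI notI)
    show "less_in Q x y" using c lessR[OF xy] by (auto simp: covers_def)
    assume "\<exists>w. less_in Q x w \<and> less_in Q w y"
    then obtain w where w: "less_in Q x w" "less_in Q w y" by blast
    then have "w \<in> Field Q" by (auto simp: less_in_def Field_def)
    then have "less_in ?R (e x) (e w)" "less_in ?R (e w) (e y)" using w lessR xy by blast+
    then show False using c by (auto simp: covers_def)
  qed
  have rankR': "is_rank_function ?R (\<lambda>i. rank Q (?d i))"
    unfolding is_rank_function_def
  proof (intro conjI allI impI)
    have "is_rank_function Q (rank Q)" unfolding rank_def by (rule someI[of _ f]) (rule Q)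
    then have r: "rank Q z = 0" "\<And>x y. covers Q x y \<Longrightarrow> rank Q y = Suc (rank Q x)"
      using bottom_eqI[OF Q(2,3)] by (auto simp: is_rank_function_def)
    show "rank Q (?d (bottom ?R)) = 0" using bottom_eqI[OF poR botR] d z r by simp
    fix i j assume c: "covers ?R i j"
    then have "i \<in> e ` Field Q" "j \<in> e ` Field Q"
      unfolding FR[symmetric] by (auto simp: covers_def less_in_def Field_def)
    then obtain x y where "x \<in> Field Q" "i = e x" "y \<in> Field Q" "j = e y" by blast
    then show "rank Q (?d j) = Suc (rank Q (?d i))" using c coversR r(2) d by simp
  qed
  have rankR: "rank ?R (e x) = rank Q x" if "x \<in> Field Q" for x
    using rank_eqI[OF finR poR botR rankR', of "e x"] that d[OF that] FR by simp
  have moebR: "moebius ?R (e z) (e x) = moebius Q z x" if x: "x \<in> Field Q" for x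
  proof -
    have "moebius ?R (e z) (e x) = (\<lambda>i. moebius Q z (?d i)) (e x)"
    proof (rule moebius_eqI[OF finR poR botR])
      have "moebius Q z z = 1" using zQ[OF z] Q(1,2) by (subst moebius.simps) simp
      then show "moebius Q z (?d (e z)) = 1" using d z by simp
      show "e x \<in> Field ?R" using x FR by simp
      fix i assume "i \<in> Field ?R" "i \<noteq> e z"
      then obtain y where y: "y \<in> Field Q" "i = e y" "y \<noteq> z" using FR by auto
      have S: "{w. (w, i) \<in> ?R} = e ` {w. (w, y) \<in> Q}"
      proof
        show "{w. (w, i) \<in> ?R} \<subseteq> e ` {w. (w, y) \<in> Q}"
        proof
          fix j assume "j \<in> {w. (w, i) \<in> ?R}"
          then obtain v w where "(v, w) \<in> Q" "j = e v" "e w = i" by (auto simp: dir_image_def)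
          moreover from this have "w = y" using y(1,2) e by (auto simp: FieldI2 dest: inj_onD)
          ultimately show "j \<in> e ` {w. (w, y) \<in> Q}" by blast
        qed
      qed (auto simp: dir_image_def y(2))
      have "inj_on e {w. (w, y) \<in> Q}" by (rule inj_on_subset[OF e]) (auto simp: Field_def)
      then have "(\<Sum>w\<in>{w. (w, i) \<in> ?R}. moebius Q z (?d w)) = (\<Sum>w\<in>{w. (w, y) \<in> Q}. moebius Q z (?d (e w)))"
        unfolding S by (simp add: sum.reindex)
      also have "\<dots> = (\<Sum>w\<in>{w. (w, y) \<in> Q}. moebius Q z w)"
        by (rule sum.cong) (simp_all add: d FieldI1)
      also have "\<dots> = 0" using sum_moebius_eq_0[OF Q(1-3) y(1,3)] .
      finally show "(\<Sum>w\<in>{w. (w, i) \<in> ?R}. moebius Q z (?d w)) = 0" .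
    qed
    then show ?thesis using d x by simp
  qed
  have lev: "{i \<in> Field ?R. rank ?R i = k} = e ` {x \<in> Field Q. rank Q x = k}" for k
    using rankR FR by auto
  have inj: "inj_on e {x \<in> Field Q. rank Q x = k}" for k by (rule inj_on_subset[OF e]) auto
  have "whitney_second ?R k = whitney_second Q k" for k
    unfolding whitney_second_def lev using inj by (rule card_image)
  moreover have "whitney_first ?R k = whitney_first Q k" for k
    unfolding whitney_first_def lev bottom_eqI[OF poR botR] bottom_eqI[OF Q(2,3)]
    using inj by (simp add: sum.reindex moebR)
  moreover have "graded_poset ?R"
    unfolding graded_poset_def using finR poR botR rankR' by blast
  ultimately have "whitney_duals P ?R" using assms by (simp add: whitney_duals_def)
  then show ?thesis by (auto simp: has_whitney_dual_def)
qed

section \<open>Pointed partitions\<close>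

text \<open>Elementwise form of the definition. The third premise gives disjointness and, with
  \<open>i\<close> the point of a block, also that an underlying set carries only one point.\<close>

lemma pointed_partitionI:
  assumes "\<And>A p. (A, p) \<in> \<pi> \<Longrightarrow> p \<in> A \<and> A \<subseteq> {1..n}"
    and "\<And>i. i \<in> {1..n} \<Longrightarrow> \<exists>A p. (A, p) \<in> \<pi> \<and> i \<in> A"
    and "\<And>A p B q i. (A, p) \<in> \<pi> \<Longrightarrow> (B, q) \<in> \<pi> \<Longrightarrow> i \<in> A \<Longrightarrow> i \<in> B \<Longrightarrow> A = B \<and> p = q"
  shows "pointed_partition n \<pi>"
  unfolding pointed_partition_def
proof (intro conjI)
  show "\<forall>(A, p)\<in>\<pi>. p \<in> A" using assms(1) by blast
  show "inj_on fst \<pi>"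
  proof (rule inj_onI)
    fix X Y assume X: "X \<in> \<pi>" and Y: "Y \<in> \<pi>" and eq: "fst X = fst Y"
    obtain A p where Xp: "X = (A, p)" by (cases X)
    obtain q where Yq: "Y = (A, q)" using eq Xp by (cases Y) auto
    have "p \<in> A" using assms(1) X Xp by blast
    then show "X = Y" using assms(3)[of A p A q p] X Y Xp Yq by blast
  qed
  show "partition_on {1..n} (fst ` \<pi>)"
  proof (rule partition_onI)
    show "\<Union> (fst ` \<pi>) = {1..n}"
    proof (intro equalityI subsetI)
      fix i assume "i \<in> \<Union> (fst ` \<pi>)"
      then obtain A p where "(A, p) \<in> \<pi>" "i \<in> A" by auto
      then show "i \<in> {1..n}" using assms(1) by blast
    next
      fix i assume "i \<in> {1..n}"
      then obtain A p where "(A, p) \<in> \<pi>" "i \<in> A" using assms(2) by blast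
      then show "i \<in> \<Union> (fst ` \<pi>)" by force
    qed
    show "{} \<notin> fst ` \<pi>"
    proof
      assume "{} \<in> fst ` \<pi>"
      then obtain p where "({}, p) \<in> \<pi>" by auto
      then show False using assms(1) by blast
    qed
    fix X Y assume X: "X \<in> fst ` \<pi>" and Y: "Y \<in> fst ` \<pi>" and "X \<noteq> Y"
    obtain p where "(X, p) \<in> \<pi>" using X by auto
    moreover obtain q where "(Y, q) \<in> \<pi>" using Y by auto
    ultimately show "disjnt X Y"
      using assms(3)[of X p Y q] \<open>X \<noteq> Y\<close> by (auto simp: disjnt_def)
  qed
qed

lemma point_in_block:
  assumes "pointed_partition n \<pi>" "(A, p) \<in> \<pi>"
  shows "p \<in> A"
  using assms by (auto simp: pointed_partition_def)

lemma block_subset: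
  assumes "pointed_partition n \<pi>" "(A, p) \<in> \<pi>"
  shows "A \<subseteq> {1..n}"
proof -
  have "{1..n} = \<Union> (fst ` \<pi>)"
    using assms(1) by (simp add: pointed_partition_def partition_onD1)
  moreover have "A \<in> fst ` \<pi>" using assms(2) by force
  ultimately show ?thesis by blast
qed

lemma finite_block:
  assumes "pointed_partition n \<pi>" "(A, p) \<in> \<pi>"
  shows "finite A"
  using finite_subset[OF block_subset[OF assms]] by simp

lemma Min_block:
  assumes "pointed_partition n \<pi>" "(A, p) \<in> \<pi>"
  shows "Min A \<in> A"
  using finite_block[OF assms] point_in_block[OF assms] by (auto intro: Min_in)

lemma Min_block_le:
  assumes "pointed_partition n \<pi>" "(A, p) \<in> \<pi>" "i \<in> A"
  shows "Min A \<le> i"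
  using finite_block[OF assms(1,2)] assms(3) by simp

lemma ex_block:
  assumes "pointed_partition n \<pi>" "i \<in> {1..n}"
  obtains A p where "(A, p) \<in> \<pi>" "i \<in> A"
proof -
  have "{1..n} = \<Union> (fst ` \<pi>)" using assms by (simp add: pointed_partition_def partition_onD1)
  then show thesis using assms(2) that by auto
qed

lemma block_unique:
  assumes "pointed_partition n \<pi>" "(A, p) \<in> \<pi>" "(B, q) \<in> \<pi>" "i \<in> A" "i \<in> B"
  shows "A = B \<and> p = q"
proof -
  have d: "disjoint (fst ` \<pi>)" and i: "inj_on fst \<pi>"
    using assms(1) by (auto simp: pointed_partition_def dest: partition_onD2)
  have "A = B"
  proof (rule ccontr)
    assume "A \<noteq> B"
    moreover have "A \<in> fst ` \<pi>" "B \<in> fst ` \<pi>" using assms(2,3) by force+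
    ultimately have "A \<inter> B = {}" using d by (auto simp: disjoint_def)
    then show False using assms(4,5) by blast
  qed
  then show ?thesis using inj_onD[OF i, of "(A, p)" "(B, q)"] assms(2,3) by simp
qed

lemma block_eqI:
  assumes "pointed_partition n \<pi>" "(A, p) \<in> \<pi>" "(B, q) \<in> \<pi>" "i \<in> A" "i \<in> B"
  shows "(A, p) = (B, q)"
  using block_unique[OF assms] by simp

lemma Min_block_inj:
  assumes "pointed_partition n \<pi>" "(A, p) \<in> \<pi>" "(B, q) \<in> \<pi>" "Min A = Min B"
  shows "A = B \<and> p = q"
  using block_unique[OF assms(1-3)] Min_block[OF assms(1,2)] Min_block[OF assms(1,3)] assms(4)
  by simp

lemma finite_pointed_partitions: "finite {\<pi>. pointed_partition n \<pi>}"
proof (rule finite_subset)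
  show "{\<pi>. pointed_partition n \<pi>} \<subseteq> Pow (Pow {1..n} \<times> {1..n})"
  proof (intro subsetI PowI)
    fix \<pi> X assume "\<pi> \<in> {\<pi>. pointed_partition n \<pi>}" and X: "X \<in> \<pi>"
    then have pp: "pointed_partition n \<pi>" by simp
    obtain A p where A: "X = (A, p)" "(A, p) \<in> \<pi>" using X by (cases X) auto
    show "X \<in> Pow {1..n} \<times> {1..n}"
      using block_subset[OF pp A(2)] point_in_block[OF pp A(2)] unfolding A(1) by blast
  qed
qed simp

lemma finite_pointed_partition:
  assumes "pointed_partition n \<pi>"
  shows "finite \<pi>"
proof -
  have "finite (fst ` \<pi>)"
    using assms finite_elements[of "{1..n}"] by (simp add: pointed_partition_def)
  then show ?thesis using assms finite_imageD[of fst \<pi>] by (simp add: pointed_partition_def)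
qed

text \<open>The blocks of \<open>x\<close> already cover \<open>{1..n}\<close>, so \<open>y\<close>
  has no room for another one. Used to find a block in which two different partitions
  differ.\<close>

lemma pointed_partition_subset_eq:
  assumes "pointed_partition n x" "pointed_partition n y" "x \<subseteq> y"
  shows "x = y"
proof
  show "y \<subseteq> x"
  proof
    fix Z assume "Z \<in> y"
    then obtain C r where C: "Z = (C, r)" "(C, r) \<in> y" by (cases Z) auto
    then have r: "r \<in> C" "r \<in> {1..n}"
      using point_in_block[OF assms(2)] block_subset[OF assms(2)] by blast+
    then obtain A p where A: "(A, p) \<in> x" "r \<in> A" using ex_block[OF assms(1)] by blast
    then have "(A, p) = (C, r)" using block_eqI[OF assms(2) _ C(2) A(2) r(1)] assms(3) by blast
    then show "Z \<in> x" using A C by simp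
  qed
qed (rule assms)

subsection \<open>Merging two blocks\<close>

text \<open>Relational counterpart of \<open>lambda_bullet\<close>: usable before the description
  operator there is known to have a unique solution.\<close>

definition merges_with :: "pointed set \<Rightarrow> label \<Rightarrow> pointed set \<Rightarrow> bool" where
  "merges_with \<pi> l \<pi>' \<longleftrightarrow> (\<exists>u A p B q. merge_at u A p B q \<pi> \<pi>' \<and> l = (Min A, Min B, u))"

lemma merges_withI:
  assumes "(A, p) \<in> \<pi>" "(B, q) \<in> \<pi>" "Min A < Min B" "u \<in> {0, 1}"
    and "\<pi>' = insert (A \<union> B, if u = 1 then p else q) (\<pi> - {(A, p), (B, q)})"
    and "l = (Min A, Min B, u)"
  shows "merges_with \<pi> l \<pi>'"
  unfolding merges_with_def merge_at_def using assms by blast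

lemma merges_withE:
  assumes "merges_with \<pi> l \<pi>'"
  obtains u A p B q where "(A, p) \<in> \<pi>" "(B, q) \<in> \<pi>" "Min A < Min B" "u \<in> {0, 1}"
    "\<pi>' = insert (A \<union> B, if u = 1 then p else q) (\<pi> - {(A, p), (B, q)})"
    "l = (Min A, Min B, u)"
  using assms unfolding merges_with_def merge_at_def by blast

lemma Un_block_not_in:
  assumes "pointed_partition n \<pi>" "(A, p) \<in> \<pi>" "(B, q) \<in> \<pi>" "Min A < Min B"
  shows "(A \<union> B, r) \<notin> \<pi>"
proof
  assume r: "(A \<union> B, r) \<in> \<pi>"
  have m: "Min A \<in> A" "Min B \<in> B" using Min_block assms(1-3) by blast+
  have "A \<union> B = A" using block_unique[OF assms(1) r assms(2) UnI1 m(1)] m(1) by simp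
  moreover have "A \<union> B = B" using block_unique[OF assms(1) r assms(3) UnI2 m(2)] m(2) by simp
  ultimately show False using assms(4) by simp
qed

lemma blocks_disjoint:
  assumes "pointed_partition n \<pi>" "(A, p) \<in> \<pi>" "(B, q) \<in> \<pi>" "Min A < Min B"
  shows "A \<inter> B = {}"
  using block_unique[OF assms(1-3)] assms(4) by fastforce

lemma Min_Un_blocks:
  assumes "pointed_partition n \<pi>" "(A, p) \<in> \<pi>" "(B, q) \<in> \<pi>" "Min A < Min B"
  shows "Min (A \<union> B) = Min A"
proof -
  have "finite A" "finite B" "A \<noteq> {}" "B \<noteq> {}"
    using finite_block[OF assms(1,2)] finite_block[OF assms(1,3)]
      point_in_block[OF assms(1,2)] point_in_block[OF assms(1,3)] by auto
  then show ?thesis using assms(4) by (simp add: Min_Un)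
qed

lemma pointed_partition_merge:
  assumes pp: "pointed_partition n \<pi>" and m: "merges_with \<pi> l \<pi>'"
  shows "pointed_partition n \<pi>'"
  using m
proof (rule merges_withE)
  fix u A p B q
  assume A: "(A, p) \<in> \<pi>" and B: "(B, q) \<in> \<pi>" and lt: "Min A < Min B"
    and \<pi>': "\<pi>' = insert (A \<union> B, if u = (1::nat) then p else q) (\<pi> - {(A, p), (B, q)})"
  have sub: "p \<in> A" "q \<in> B" "A \<subseteq> {1..n}" "B \<subseteq> {1..n}"
    using point_in_block[OF pp] block_subset[OF pp] A B by blast+
  have other: "i \<notin> A \<union> B" if "(C, r) \<in> \<pi> - {(A, p), (B, q)}" "i \<in> C" for C r i
    using block_unique[OF pp _ A, of C r i] block_unique[OF pp _ B, of C r i] that by blast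
  show ?thesis
  proof (rule pointed_partitionI)
    fix C r assume "(C, r) \<in> \<pi>'"
    then consider "C = A \<union> B" "r = (if u = 1 then p else q)" | "(C, r) \<in> \<pi>"
      unfolding \<pi>' by blast
    then show "r \<in> C \<and> C \<subseteq> {1..n}"
      using point_in_block[OF pp] block_subset[OF pp] sub by cases auto
  next
    fix i assume "i \<in> {1..n}"
    then obtain C r where "(C, r) \<in> \<pi>" "i \<in> C" using ex_block[OF pp] by blast
    then show "\<exists>C r. (C, r) \<in> \<pi>' \<and> i \<in> C" unfolding \<pi>'
      by (cases "(C, r) \<in> {(A, p), (B, q)}") auto
  next
    fix C r D s i
    assume C: "(C, r) \<in> \<pi>'" and D: "(D, s) \<in> \<pi>'" and i: "i \<in> C" "i \<in> D"
    show "C = D \<and> r = s"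
    proof (cases "(C, r) \<in> \<pi> - {(A, p), (B, q)}")
      case True
      then have "(D, s) \<in> \<pi>" using C D i other[of C r i] unfolding \<pi>' by blast
      then show ?thesis using True block_unique[OF pp, of C r D s i] i by blast
    next
      case False
      then have "(C, r) = (A \<union> B, if u = 1 then p else q)" using C unfolding \<pi>' by blast
      moreover have "(D, s) = (A \<union> B, if u = 1 then p else q)"
        using calculation D i other[of D s i] unfolding \<pi>' by blast
      ultimately show ?thesis by simp
    qed
  qed
qed

lemma card_merge:
  assumes pp: "pointed_partition n \<pi>" and m: "merges_with \<pi> l \<pi>'"
  shows "Suc (card \<pi>') = card \<pi>"
  using m
proof (rule merges_withE)
  fix u A p B q
  assume A: "(A, p) \<in> \<pi>" and B: "(B, q) \<in> \<pi>" and lt: "Min A < Min B"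
    and \<pi>': "\<pi>' = insert (A \<union> B, if u = (1::nat) then p else q) (\<pi> - {(A, p), (B, q)})"
  have fin: "finite \<pi>" using pp by (rule finite_pointed_partition)
  have "(A, p) \<noteq> (B, q)" using lt by auto
  then have "card {(A, p), (B, q)} = 2" by simp
  moreover have "card {(A, p), (B, q)} \<le> card \<pi>" using A B fin by (intro card_mono) auto
  moreover have "card (\<pi> - {(A, p), (B, q)}) = card \<pi> - card {(A, p), (B, q)}"
    using A B by (intro card_Diff_subset) auto
  ultimately show ?thesis
    unfolding \<pi>' using fin Un_block_not_in[OF pp A B lt] by simp
qed

text \<open>The two minima in the label name the blocks, and its third component selects the
  surviving point.\<close>

lemma merges_with_functional:
  assumes pp: "pointed_partition n \<pi>" and "merges_with \<pi> l x" "merges_with \<pi> l y"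
  shows "x = y"
proof -
  from assms(2) obtain u A p B q where 1: "(A, p) \<in> \<pi>" "(B, q) \<in> \<pi>"
    "x = insert (A \<union> B, if u = 1 then p else q) (\<pi> - {(A, p), (B, q)})" "l = (Min A, Min B, u)"
    by (rule merges_withE)
  from assms(3) obtain v C r D s where 2: "(C, r) \<in> \<pi>" "(D, s) \<in> \<pi>"
    "y = insert (C \<union> D, if v = 1 then r else s) (\<pi> - {(C, r), (D, s)})" "l = (Min C, Min D, v)"
    by (rule merges_withE)
  have "A = C \<and> p = r" using Min_block_inj[OF pp 1(1) 2(1)] 1(4) 2(4) by simp
  moreover have "B = D \<and> q = s" using Min_block_inj[OF pp 1(2) 2(2)] 1(4) 2(4) by simp
  ultimately show ?thesis using 1 2 by simp
qed

text \<open>The merge can be read off from the set differences: \<open>\<pi>' - \<pi>\<close> is the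
  new block and \<open>\<pi> - \<pi>'\<close> consists of the two old ones. As the old points
  differ, the new point reveals \<open>u\<close>.\<close>

lemma merge_label_unique:
  assumes pp: "pointed_partition n \<pi>" and "merges_with \<pi> l \<pi>'" "merges_with \<pi> l' \<pi>'"
  shows "l = l'"
proof -
  from assms(2) obtain u A p B q
    where 1: "(A, p) \<in> \<pi>" "(B, q) \<in> \<pi>" "Min A < Min B" "u \<in> {0, 1}"
    "\<pi>' = insert (A \<union> B, if u = 1 then p else q) (\<pi> - {(A, p), (B, q)})" "l = (Min A, Min B, u)"
    by (rule merges_withE)
  from assms(3) obtain v C r D s
    where 2: "(C, r) \<in> \<pi>" "(D, s) \<in> \<pi>" "Min C < Min D" "v \<in> {0, 1}"
    "\<pi>' = insert (C \<union> D, if v = 1 then r else s) (\<pi> - {(C, r), (D, s)})" "l' = (Min C, Min D, v)"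
    by (rule merges_withE)
  have n: "(A \<union> B, t) \<notin> \<pi>" "(C \<union> D, t) \<notin> \<pi>" for t
    using Un_block_not_in[OF pp 1(1-3)] Un_block_not_in[OF pp 2(1-3)] by blast+
  have "\<pi>' - \<pi> = {(A \<union> B, if u = 1 then p else q)}" unfolding 1(5) using n by auto
  moreover have "\<pi>' - \<pi> = {(C \<union> D, if v = 1 then r else s)}" unfolding 2(5)
    using n by auto
  ultimately have pt: "(if u = 1 then p else q) = (if v = 1 then r else s)" by simp
  have "\<pi> - \<pi>' = {(A, p), (B, q)}" unfolding 1(5) using n 1(1,2) by auto
  moreover have "\<pi> - \<pi>' = {(C, r), (D, s)}" unfolding 2(5) using n 2(1,2) by auto
  ultimately have "{(A, p), (B, q)} = {(C, r), (D, s)}" by simp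
  then have eq: "A = C" "p = r" "B = D" "q = s" using 1(3) 2(3) by (auto simp: doubleton_eq_iff)
  have "p \<noteq> q"
    using point_in_block[OF pp 1(1)] point_in_block[OF pp 1(2)] blocks_disjoint[OF pp 1(1-3)] by blast
  then have "u = v" using pt eq 1(4) 2(4) by (auto split: if_splits)
  then show ?thesis using 1(6) 2(6) eq by simp
qed

lemma lambda_bullet_eq:
  assumes "pointed_partition n \<pi>" "merges_with \<pi> l \<pi>'"
  shows "lambda_bullet \<pi> \<pi>' = l"
  unfolding lambda_bullet_def merges_with_def[symmetric]
  using assms(2) merge_label_unique[OF assms(1)] by blast

subsection \<open>The order on pointed partitions\<close>

text \<open>Closed form of the merge order. Merging creates no points: the point \<open>r\<close> of
  a large block is the point of one of its pieces, so it can fall into \<open>A\<close> only as the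
  point of \<open>A\<close>.\<close>

definition pointed_refines :: "pointed set \<Rightarrow> pointed set \<Rightarrow> bool" where
  "pointed_refines x y \<longleftrightarrow> (\<forall>(A, p)\<in>x. \<exists>(C, r)\<in>y. A \<subseteq> C \<and> (r \<in> A \<longrightarrow> r = p))"

lemma pointed_refinesD:
  assumes "pointed_refines x y" "(A, p) \<in> x"
  obtains C r where "(C, r) \<in> y" "A \<subseteq> C" "r \<in> A \<longrightarrow> r = p"
  using assms unfolding pointed_refines_def by blast

lemma pointed_refines_refl: "pointed_refines x x"
  by (auto simp: pointed_refines_def)

lemma pointed_refines_trans:
  assumes "pointed_refines x y" "pointed_refines y z"
  shows "pointed_refines x z"
  unfolding pointed_refines_def
proof (rule ballI, rule case_prodI2)
  fix X A p assume "X \<in> x" "X = (A, p)"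
  then obtain C r where C: "(C, r) \<in> y" "A \<subseteq> C" "r \<in> A \<longrightarrow> r = p" using pointed_refinesD[OF assms(1)] by blast
  then obtain D s where "(D, s) \<in> z" "C \<subseteq> D" "s \<in> C \<longrightarrow> s = r"
    using pointed_refinesD[OF assms(2)] by blast
  then show "\<exists>(D, s)\<in>z. A \<subseteq> D \<and> (s \<in> A \<longrightarrow> s = p)" using C by blast
qed

lemma pointed_refines_block:
  assumes "pointed_refines x y" "pointed_partition n y" "(A, p) \<in> x" "(C, r) \<in> y" "i \<in> A" "i \<in> C"
  shows "A \<subseteq> C" "r \<in> A \<Longrightarrow> r = p"
proof -
  obtain D s where D: "(D, s) \<in> y" "A \<subseteq> D" "s \<in> A \<longrightarrow> s = p"
    using pointed_refinesD[OF assms(1,3)] by blast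
  then have "D = C \<and> s = r" using block_unique[OF assms(2) D(1) assms(4), of i] assms(5,6) by blast
  then show "A \<subseteq> C" "r \<in> A \<Longrightarrow> r = p" using D by auto
qed

lemma merges_with_pointed_refines:
  assumes pp: "pointed_partition n \<pi>" and m: "merges_with \<pi> l \<pi>'"
  shows "pointed_refines \<pi> \<pi>'"
  using m
proof (rule merges_withE)
  fix u A p B q
  assume A: "(A, p) \<in> \<pi>" and B: "(B, q) \<in> \<pi>" and lt: "Min A < Min B"
    and \<pi>': "\<pi>' = insert (A \<union> B, if u = (1::nat) then p else q) (\<pi> - {(A, p), (B, q)})"
  have d: "p \<in> A" "q \<in> B" "A \<inter> B = {}"
    using point_in_block[OF pp A] point_in_block[OF pp B] blocks_disjoint[OF pp A B lt] by auto
  show ?thesis unfolding pointed_refines_def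
  proof (rule ballI, rule case_prodI2)
    fix X C r assume X: "X \<in> \<pi>" "X = (C, r)"
    show "\<exists>(D, s)\<in>\<pi>'. C \<subseteq> D \<and> (s \<in> C \<longrightarrow> s = r)"
    proof (cases "X \<in> {(A, p), (B, q)}")
      case True
      then show ?thesis unfolding \<pi>' using X d by (auto split: if_splits)
    next
      case False
      then show ?thesis unfolding \<pi>' using X by blast
    qed
  qed
qed

text \<open>The last premise says that the block whose point is discarded must not contain the final
  point \<open>r\<close>; this is all that can go wrong when two pieces of \<open>C\<close> are
  merged.\<close>

lemma merge_pointed_refinesI:
  assumes "pointed_refines x y" "(C, r) \<in> y" "A \<subseteq> C" "B \<subseteq> C"
    and "s = p \<and> (r \<in> A \<longrightarrow> r = p) \<and> r \<notin> B \<or> s = q \<and> (r \<in> B \<longrightarrow> r = q) \<and> r \<notin> A"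
  shows "pointed_refines (insert (A \<union> B, s) (x - {(A, p), (B, q)})) y"
  unfolding pointed_refines_def
proof (rule ballI, rule case_prodI2)
  fix X D t assume X: "X \<in> insert (A \<union> B, s) (x - {(A, p), (B, q)})" "X = (D, t)"
  show "\<exists>(E, v)\<in>y. D \<subseteq> E \<and> (v \<in> D \<longrightarrow> v = t)"
  proof (cases "X = (A \<union> B, s)")
    case True
    then have Dt: "D = A \<union> B" "t = s" using X(2) by auto
    have "A \<union> B \<subseteq> C" using assms(3,4) by blast
    moreover have "r \<in> A \<union> B \<longrightarrow> r = s" using assms(5) by blast
    ultimately show ?thesis using assms(2) unfolding Dt by blast
  next
    case False
    then have "(D, t) \<in> x" using X by blast
    then obtain E v where "(E, v) \<in> y" "D \<subseteq> E" "v \<in> D \<longrightarrow> v = t"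
      by (rule pointed_refinesD[OF assms(1)])
    then show ?thesis by blast
  qed
qed

subsection \<open>The first label of an increasing chain\<close>

text \<open>
  The label that an increasing chain from \<open>x\<close> to \<open>y\<close> must start with: among the blocks of \<open>y\<close>
  that are not blocks of \<open>x\<close>, the one with least minimum is assembled first.  If its point lies
  outside the \<open>x\<close>-block \<open>A\<close> that contains this minimum, the only \<open>0\<close>-merge has to come first and
  to bring in the point; otherwise \<open>1\<close>-merges absorb the remaining \<open>x\<close>-blocks in order of minima.
\<close>

definition canonical_label :: "pointed set \<Rightarrow> pointed set \<Rightarrow> label \<Rightarrow> bool" where
  "canonical_label x y l \<longleftrightarrow>
     (\<exists>C r A p B q u. l = (Min A, Min B, u) \<and>
        (C, r) \<in> y \<and> (C, r) \<notin> x \<and> (\<forall>C' r'. (C', r') \<in> y \<longrightarrow> (C', r') \<notin> x \<longrightarrow> Min C \<le> Min C') \<and>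
        (A, p) \<in> x \<and> A \<subseteq> C \<and> Min A = Min C \<and> (B, q) \<in> x \<and> B \<subseteq> C - A \<and>
        (if r \<in> A then u = 1 \<and> Min B = Min (C - A) else u = 0 \<and> r \<in> B))"

lemma canonical_labelI:
  assumes "(C, r) \<in> y" "(C, r) \<notin> x"
    "\<And>C' r'. (C', r') \<in> y \<Longrightarrow> (C', r') \<notin> x \<Longrightarrow> Min C \<le> Min C'"
    "(A, p) \<in> x" "A \<subseteq> C" "Min A = Min C" "(B, q) \<in> x" "B \<subseteq> C - A"
    "r \<in> A \<Longrightarrow> u = 1 \<and> Min B = Min (C - A)" "r \<notin> A \<Longrightarrow> u = 0 \<and> r \<in> B"
  shows "canonical_label x y (Min A, Min B, u)"
  unfolding canonical_label_def using assms
  by (intro exI[of _ C] exI[of _ r] exI[of _ A] exI[of _ p] exI[of _ B] exI[of _ q] exI[of _ u]) simp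

lemma canonical_labelE:
  assumes "canonical_label x y l"
  obtains C r A p B q u where "l = (Min A, Min B, u)" "(C, r) \<in> y" "(C, r) \<notin> x"
    "\<And>C' r'. (C', r') \<in> y \<Longrightarrow> (C', r') \<notin> x \<Longrightarrow> Min C \<le> Min C'"
    "(A, p) \<in> x" "A \<subseteq> C" "Min A = Min C" "(B, q) \<in> x" "B \<subseteq> C - A"
    "r \<in> A \<Longrightarrow> u = 1 \<and> Min B = Min (C - A)" "r \<notin> A \<Longrightarrow> u = 0 \<and> r \<in> B"
proof -
  from assms obtain C r A p B q u where *: "l = (Min A, Min B, u)"
    "(C, r) \<in> y" "(C, r) \<notin> x" "\<forall>C' r'. (C', r') \<in> y \<longrightarrow> (C', r') \<notin> x \<longrightarrow> Min C \<le> Min C'"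
    "(A, p) \<in> x" "A \<subseteq> C" "Min A = Min C" "(B, q) \<in> x" "B \<subseteq> C - A"
    "if r \<in> A then u = 1 \<and> Min B = Min (C - A) else u = 0 \<and> r \<in> B"
    unfolding canonical_label_def by (elim exE conjE)
  show thesis
    by (rule that[OF *(1-3) _ *(5-9)]) (use *(4,10) in simp_all)
qed

text \<open>\<open>C\<close> is named by the least minimum of a new block, \<open>A\<close> by the
  same minimum, and \<open>B\<close> either by \<open>Min (C - A)\<close> or by containing
  \<open>r\<close>; the case is decided by \<open>r \<in> A\<close>.\<close>

lemma canonical_label_unique:
  assumes x: "pointed_partition n x" and y: "pointed_partition n y"
    and "canonical_label x y l" "canonical_label x y l'"
  shows "l = l'"
proof -
  from assms(3) obtain C r A p B q u
    where 1: "l = (Min A, Min B, u)" "(C, r) \<in> y" "(C, r) \<notin> x"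
    "\<And>C' r'. (C', r') \<in> y \<Longrightarrow> (C', r') \<notin> x \<Longrightarrow> Min C \<le> Min C'"
    "(A, p) \<in> x" "A \<subseteq> C" "Min A = Min C" "(B, q) \<in> x" "B \<subseteq> C - A"
    "r \<in> A \<Longrightarrow> u = 1 \<and> Min B = Min (C - A)" "r \<notin> A \<Longrightarrow> u = 0 \<and> r \<in> B"
    by (rule canonical_labelE) blast
  from assms(4) obtain C' r' A' p' B' q' u'
    where 2: "l' = (Min A', Min B', u')" "(C', r') \<in> y" "(C', r') \<notin> x"
    "\<And>D s. (D, s) \<in> y \<Longrightarrow> (D, s) \<notin> x \<Longrightarrow> Min C' \<le> Min D"
    "(A', p') \<in> x" "A' \<subseteq> C'" "Min A' = Min C'" "(B', q') \<in> x" "B' \<subseteq> C' - A'"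
    "r' \<in> A' \<Longrightarrow> u' = 1 \<and> Min B' = Min (C' - A')" "r' \<notin> A' \<Longrightarrow> u' = 0 \<and> r' \<in> B'"
    by (rule canonical_labelE) blast
  have "Min C = Min C'" using 1(4)[OF 2(2,3)] 2(4)[OF 1(2,3)] by simp
  then have C: "C = C'" "r = r'" using Min_block_inj[OF y 1(2) 2(2)] by simp_all
  have A: "A = A'" using Min_block_inj[OF x 1(5) 2(5)] 1(7) 2(7) C by simp
  show ?thesis
  proof (cases "r \<in> A")
    case True
    then show ?thesis using 1(1,10) 2(1,10) A C by simp
  next
    case False
    then have "B = B'" using block_unique[OF x 1(8) 2(8), of r] 1(11) 2(11) A C by simp
    then show ?thesis using False 1(1,11) 2(1,11) A C by simp
  qed
qed

text \<open>The greedy step towards \<open>y\<close>. It serves three times: to reach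
  \<open>y\<close> by merges, to identify covers, and to start an increasing chain.\<close>

lemma ex_canonical_merge:
  assumes x: "pointed_partition n x" and y: "pointed_partition n y"
    and co: "pointed_refines x y" and ne: "x \<noteq> y"
  obtains l x' where "merges_with x l x'" "canonical_label x y l" "pointed_refines x' y"
proof -
  let ?S = "y - x"
  have "\<not> y \<subseteq> x" using pointed_partition_subset_eq[OF y x] ne by blast
  then have S: "finite ?S" "?S \<noteq> {}" using finite_pointed_partition[OF y] by auto
  obtain C r where Cr: "arg_min_on (\<lambda>Z. Min (fst Z)) ?S = (C, r)"
    by (cases "arg_min_on (\<lambda>Z. Min (fst Z)) ?S")
  then have C: "(C, r) \<in> y" "(C, r) \<notin> x"
    using arg_min_if_finite(1)[OF S, of "\<lambda>Z. Min (fst Z)"] by auto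
  have minC: "Min C \<le> Min C'" if "(C', r') \<in> y" "(C', r') \<notin> x" for C' r'
    using arg_min_least[OF S, of "(C', r')" "\<lambda>Z. Min (fst Z)"] that Cr by simp
  have mC: "Min C \<in> C" using Min_block[OF y C(1)] .
  have r: "r \<in> C" using point_in_block[OF y C(1)] .
  have Cn: "C \<subseteq> {1..n}" using block_subset[OF y C(1)] .
  have "Min C \<in> {1..n}" using mC Cn by blast
  then obtain A p where A: "(A, p) \<in> x" "Min C \<in> A" using ex_block[OF x] by blast
  have AC: "A \<subseteq> C" and rA: "r \<in> A \<Longrightarrow> r = p"
    using pointed_refines_block[OF co y A(1) C(1) A(2) mC] by blast+
  have mA: "Min A = Min C"
  proof (rule antisym)
    show "Min A \<le> Min C" using Min_block_le[OF x A] .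
    show "Min C \<le> Min A" using Min_block_le[OF y C(1)] Min_block[OF x A(1)] AC by blast
  qed
  \<comment> \<open>Otherwise \<open>r\<close> would lie in \<open>A\<close>, hence equal
    \<open>p\<close>, and \<open>(C, r)\<close> would be a block of \<open>x\<close>.\<close>
  have "A \<noteq> C" using A C r rA by auto
  have fin: "finite (C - A)" using finite_block[OF y C(1)] by simp
  \<comment> \<open>Any \<open>x\<close>-block that meets \<open>C - A\<close> is a legitimate
    second partner for \<open>A\<close>; the two cases only differ in the element \<open>b\<close>
    used to choose it.\<close>
  have sub: "B \<subseteq> C - A" "r \<in> B \<Longrightarrow> r = q" "Min A < Min B"
    if B: "(B, q) \<in> x" and b: "b \<in> B" "b \<in> C - A" for B q b
  proof -
    show "r \<in> B \<Longrightarrow> r = q"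
      using pointed_refines_block(2)[OF co y B C(1) b(1)] b(2) by blast
    have "B \<inter> A = {}"
    proof (rule ccontr)
      assume "B \<inter> A \<noteq> {}"
      then obtain i where "i \<in> B" "i \<in> A" by blast
      then have "B = A" using block_unique[OF x B A(1)] by blast
      then show False using b by blast
    qed
    then show BCA: "B \<subseteq> C - A"
      using pointed_refines_block(1)[OF co y B C(1) b(1)] b(2) by blast
    then have mB: "Min B \<in> C - A" using Min_block[OF x B] by blast
    then have "Min C \<le> Min B" using Min_block_le[OF y C(1)] by blast
    moreover have "Min B \<noteq> Min A" using mB Min_block[OF x A(1)] by auto
    ultimately show "Min A < Min B" using mA by simp
  qed
  show thesis
  proof (cases "r \<in> A")
    case True
    let ?b = "Min (C - A)"
    have b: "?b \<in> C - A" using fin AC \<open>A \<noteq> C\<close> by (intro Min_in) auto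
    then have "?b \<in> {1..n}" using Cn by blast
    then obtain B q where B: "(B, q) \<in> x" "?b \<in> B" using ex_block[OF x] by blast
    note s = sub[OF B b]
    have mB: "Min B = ?b"
    proof (rule antisym)
      show "Min B \<le> ?b" using Min_block_le[OF x B] .
      have "Min B \<in> C - A" using Min_block[OF x B(1)] s(1) by blast
      then show "?b \<le> Min B" using fin by simp
    qed
    let ?x' = "insert (A \<union> B, p) (x - {(A, p), (B, q)})"
    show thesis
    proof (rule that)
      show "merges_with x (Min A, Min B, 1) ?x'"
        by (rule merges_withI[OF A(1) B(1) s(3)]) simp_all
      show "canonical_label x y (Min A, Min B, 1)"
        by (rule canonical_labelI[OF C minC A(1) AC mA B(1) s(1)]) (simp_all add: True mB)
      show "pointed_refines ?x' y"
        by (rule merge_pointed_refinesI[OF co C(1) AC]) (use s(1) rA True in blast)+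
    qed
  next
    case False
    then have b: "r \<in> C - A" using r by blast
    then have "r \<in> {1..n}" using Cn by blast
    then obtain B q where B: "(B, q) \<in> x" "r \<in> B" using ex_block[OF x] by blast
    note s = sub[OF B b]
    let ?x' = "insert (A \<union> B, q) (x - {(A, p), (B, q)})"
    show thesis
    proof (rule that)
      show "merges_with x (Min A, Min B, 0) ?x'"
        by (rule merges_withI[OF A(1) B(1) s(3)]) simp_all
      show "canonical_label x y (Min A, Min B, 0)"
        by (rule canonical_labelI[OF C minC A(1) AC mA B(1) s(1)]) (simp_all add: False B)
      show "pointed_refines ?x' y"
        by (rule merge_pointed_refinesI[OF co C(1) AC]) (use s(1,2) False in blast)+
    qed
  qed
qed

text \<open>The strict order of the ordinal sum, unfolded: \<open>a\<close> decides first, then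
  antichain before chain, and \<open>b\<close> counts only within the chain.\<close>

fun label_less :: "label \<Rightarrow> label \<Rightarrow> bool" where
  "label_less (a, b, u) (c, d, v) \<longleftrightarrow> a < c \<or> a = c \<and> (u < v \<or> u = 1 \<and> v = 1 \<and> b < d)"

text \<open>Either the next label belongs to a block of \<open>y\<close> with larger minimum, or
  \<open>C\<close> is continued. In the latter case \<open>A \<union> B\<close> contains
  \<open>r\<close>, so a \<open>1\<close>-merge follows; the earlier merge was a
  \<open>0\<close>-merge, or a \<open>1\<close>-merge with the smallest remaining minimum.\<close>

lemma canonical_labels_increase:
  assumes x: "pointed_partition n x" and y: "pointed_partition n y"
    and m: "merges_with x l x'" and c: "canonical_label x y l" and c': "canonical_label x' y l'"
  shows "label_less l l'"
proof -
  from c obtain C r A p B q u where 1: "l = (Min A, Min B, u)" "(C, r) \<in> y" "(C, r) \<notin> x"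
    "\<And>C' r'. (C', r') \<in> y \<Longrightarrow> (C', r') \<notin> x \<Longrightarrow> Min C \<le> Min C'"
    "(A, p) \<in> x" "A \<subseteq> C" "Min A = Min C" "(B, q) \<in> x" "B \<subseteq> C - A"
    "r \<in> A \<Longrightarrow> u = 1 \<and> Min B = Min (C - A)" "r \<notin> A \<Longrightarrow> u = 0 \<and> r \<in> B"
    by (rule canonical_labelE) blast
  from c' obtain C' r' A' p' B' q' u'
    where 2: "l' = (Min A', Min B', u')" "(C', r') \<in> y" "(C', r') \<notin> x'"
    "(A', p') \<in> x'" "A' \<subseteq> C'" "Min A' = Min C'" "(B', q') \<in> x'" "B' \<subseteq> C' - A'"
    "r' \<in> A' \<Longrightarrow> u' = 1 \<and> Min B' = Min (C' - A')" "r' \<notin> A' \<Longrightarrow> u' = 0 \<and> r' \<in> B'"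
    by (rule canonical_labelE) blast
  from m obtain u0 A0 p0 B0 q0
    where m0: "(A0, p0) \<in> x" "(B0, q0) \<in> x" "Min A0 < Min B0" "u0 \<in> {0, 1}"
    "x' = insert (A0 \<union> B0, if u0 = 1 then p0 else q0) (x - {(A0, p0), (B0, q0)})"
    "l = (Min A0, Min B0, u0)"
    by (rule merges_withE)
  have "A0 = A \<and> p0 = p" "B0 = B \<and> q0 = q"
    using Min_block_inj[OF x m0(1) 1(5)] Min_block_inj[OF x m0(2) 1(8)] 1(1) m0(6) by simp_all
  then have lt: "Min A < Min B"
    and x': "x' = insert (A \<union> B, if u0 = 1 then p else q) (x - {(A, p), (B, q)})"
    using m0(3,5) by auto
  have ppx': "pointed_partition n x'" using pointed_partition_merge[OF x m] .
  \<comment> \<open>The merge removes only \<open>A\<close> and \<open>B\<close>. Both lie inside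
    \<open>C\<close>, so a block of \<open>y\<close> equal to one of them would be \<open>C\<close>,
    which is not in \<open>x\<close>.\<close>
  have "(C', r') \<notin> x"
  proof
    assume "(C', r') \<in> x"
    then have "C' = A \<or> C' = B" using 2(3) unfolding x' by blast
    then have "r' \<in> C" using point_in_block[OF y 2(2)] 1(6,9) by blast
    then have "(C', r') = (C, r)" using block_eqI[OF y 2(2) 1(2) point_in_block[OF y 2(2)]] by simp
    then show False using \<open>(C', r') \<in> x\<close> 1(3) by simp
  qed
  then have le: "Min C \<le> Min C'" using 1(4)[OF 2(2)] by simp
  show ?thesis
  proof (cases "Min C < Min C'")
    case True
    then show ?thesis using 1(1,7) 2(1,6) by simp
  next
    case False
    then have mm: "Min C = Min C'" using le by simp
    then have C: "C' = C" "r' = r" using Min_block_inj[OF y 1(2) 2(2)] by simp_all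
    have "(A \<union> B, if u0 = 1 then p else q) \<in> x'" unfolding x' by simp
    moreover have "Min A' = Min (A \<union> B)" using Min_Un_blocks[OF x 1(5,8) lt] 1(7) 2(6) mm by simp
    ultimately have A': "A' = A \<union> B" using Min_block_inj[OF ppx' 2(4)] by blast
    have "r' \<in> A'" using 1(11) A' C by blast
    then have u': "u' = 1" "Min B' = Min (C - (A \<union> B))" using 2(9) A' C by simp_all
    have "Min B' \<in> C - (A \<union> B)" using Min_block[OF ppx' 2(7)] 2(8) A' C by blast
    then have B': "Min B' \<in> C - A" "Min B' \<noteq> Min B" using Min_block[OF x 1(8)] by auto
    have "Min (C - A) \<le> Min B'" using B'(1) finite_block[OF y 1(2)] by simp
    then show ?thesis
      using 1(1,7,10,11) 2(1,6) mm u' B'(2) by (cases "r \<in> A") auto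
  qed
qed

text \<open>The merge that completes a block of \<open>y\<close>: here \<open>C - A\<close> is
  \<open>B\<close> itself, so the demand on \<open>Min B\<close> is automatic, and \<open>u\<close>
  records which piece carries the final point.\<close>

lemma canonical_label_merged_block:
  assumes x: "pointed_partition n x" and A: "(A, p) \<in> x" and B: "(B, q) \<in> x"
    and lt: "Min A < Min B"
    and u: "u \<in> {0, 1}" and AB: "(A \<union> B, if u = 1 then p else q) \<in> y"
    and min: "\<And>C r. (C, r) \<in> y \<Longrightarrow> (C, r) \<notin> x \<Longrightarrow> Min A \<le> Min C"
  shows "canonical_label x y (Min A, Min B, u)"
proof (rule canonical_labelI[OF AB _ _ A _ _ B])
  note d = blocks_disjoint[OF x A B lt]
  note mAB = Min_Un_blocks[OF x A B lt]
  have pq: "p \<in> A" "q \<in> B" using point_in_block[OF x] A B by blast+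
  have "A \<union> B - A = B" using d by blast
  then show "u = 1 \<and> Min B = Min (A \<union> B - A)" if "(if u = 1 then p else q) \<in> A"
    using that pq d by (auto split: if_splits)
  show "u = 0 \<and> (if u = 1 then p else q) \<in> B" if "(if u = 1 then p else q) \<notin> A"
    using that pq u by (auto split: if_splits)
  show "(A \<union> B, if u = 1 then p else q) \<notin> x" using Un_block_not_in[OF x A B lt] .
  show "B \<subseteq> A \<union> B - A" using d by blast
  show "Min (A \<union> B) \<le> Min C'" if "(C', r') \<in> y" "(C', r') \<notin> x" for C' r'
    using min[OF that] mAB by simp
  show "Min A = Min (A \<union> B)" using mAB by simp
qed simp

lemma canonical_label_single_merge:
  assumes x: "pointed_partition n x" and m: "merges_with x l y"
  shows "canonical_label x y l"
proof -
  from m obtain u A p B q where m0: "(A, p) \<in> x" "(B, q) \<in> x" "Min A < Min B" "u \<in> {0, 1}"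
    "y = insert (A \<union> B, if u = 1 then p else q) (x - {(A, p), (B, q)})" "l = (Min A, Min B, u)"
    by (rule merges_withE)
  show ?thesis unfolding m0(6)
  proof (rule canonical_label_merged_block[OF x m0(1-4)])
    fix C r assume "(C, r) \<in> y" "(C, r) \<notin> x"
    then have "C = A \<union> B" unfolding m0(5) by blast
    then show "Min A \<le> Min C" using Min_Un_blocks[OF x m0(1-3)] by simp
  qed (simp add: m0(5))
qed

text \<open>The converse of \<open>canonical_labels_increase\<close>: an ascent into a canonical
  label can only start from a canonical label. Either the first merge finishes a block of
  \<open>y\<close> that precedes \<open>C\<close>, or it works on \<open>C\<close>; then the ascent
  forces \<open>u' = 1\<close>, so \<open>r\<close> already lies in \<open>A \<union> B\<close>, and
  a first \<open>1\<close>-merge must have absorbed the smallest minimum available.\<close>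

lemma canonical_label_extend:
  assumes x: "pointed_partition n x" and y: "pointed_partition n y"
    and m: "merges_with x l x'" and co: "pointed_refines x' y"
    and c': "canonical_label x' y l'" and less: "label_less l l'"
  shows "canonical_label x y l"
proof -
  from c' obtain C r A' p' B' q' u'
    where 2: "l' = (Min A', Min B', u')" "(C, r) \<in> y" "(C, r) \<notin> x'"
    "\<And>D s. (D, s) \<in> y \<Longrightarrow> (D, s) \<notin> x' \<Longrightarrow> Min C \<le> Min D"
    "(A', p') \<in> x'" "A' \<subseteq> C" "Min A' = Min C" "(B', q') \<in> x'" "B' \<subseteq> C - A'"
    "r \<in> A' \<Longrightarrow> u' = 1 \<and> Min B' = Min (C - A')" "r \<notin> A' \<Longrightarrow> u' = 0 \<and> r \<in> B'"
    by (rule canonical_labelE) blast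
  from m obtain u A p B q where 1: "(A, p) \<in> x" "(B, q) \<in> x" "Min A < Min B" "u \<in> {0, 1}"
    "x' = insert (A \<union> B, if u = 1 then p else q) (x - {(A, p), (B, q)})" "l = (Min A, Min B, u)"
    by (rule merges_withE)
  let ?s = "if u = 1 then p else q"
  have ppx': "pointed_partition n x'" using pointed_partition_merge[OF x m] .
  have AB: "(A \<union> B, ?s) \<in> x'" unfolding 1(5) by simp
  have mAB: "Min (A \<union> B) = Min A" using Min_Un_blocks[OF x 1(1-3)] .
  have le: "Min A \<le> Min C" using less 1(6) 2(1,7) by auto
  have min: "Min A \<le> Min D" if "(D, s) \<in> y" "(D, s) \<notin> x" for D s
  proof (cases "(D, s) \<in> x'")
    case True
    then have "D = A \<union> B" using that unfolding 1(5) by blast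
    then show ?thesis using mAB by simp
  next
    case False
    then show ?thesis using 2(4)[OF that(1) False] le by simp
  qed
  obtain D s where D: "(D, s) \<in> y" "A \<union> B \<subseteq> D" "s \<in> A \<union> B \<longrightarrow> s = ?s"
    using pointed_refinesD[OF co AB] by blast
  have pt: "p \<in> A" "q \<in> B" using point_in_block[OF x] 1(1,2) by blast+
  have disj: "A \<inter> B = {}" using blocks_disjoint[OF x 1(1-3)] .
  show ?thesis
  proof (cases "Min A < Min C")
    case True
    \<comment> \<open>Every block of \<open>y\<close> with minimum below \<open>Min C\<close> is
      already present in \<open>x'\<close>, so the merged block is finished.\<close>
    have "Min D \<le> Min A" using Min_block_le[OF y D(1)] Min_block[OF x 1(1)] D(2) by blast
    then have "(D, s) \<in> x'" using 2(4)[OF D(1)] True by fastforce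
    moreover have "p \<in> D" using pt D(2) by blast
    ultimately have "(D, s) = (A \<union> B, ?s)" using block_eqI[OF ppx' _ AB, of D s p] pt(1) by blast
    then show ?thesis
      unfolding 1(6) using canonical_label_merged_block[OF x 1(1-4) _ min] D(1) by simp
  next
    case False
    then have mC: "Min A = Min C" using le by simp
    then have u': "u < u' \<or> u = 1 \<and> u' = 1 \<and> Min B < Min B'" using less 1(6) 2(1,7) by simp
    \<comment> \<open>For equal first components no label lies below a \<open>0\<close>-label. In a
      canonical label, \<open>u' = 1\<close> means that the final point has already been
      reached.\<close>
    have "u' = 1" using u' 2(10,11) by (cases "r \<in> A'") auto
    then have rA': "r \<in> A'" and mB': "Min B' = Min (C - A')" using 2(10,11) by fastforce+
    have A': "A' = A \<union> B" using Min_block_inj[OF ppx' 2(5) AB] mAB mC 2(7) by simp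
    have "D = C \<and> s = r"
      using block_unique[OF y D(1) 2(2) _ point_in_block[OF y 2(2)]] D(2) rA' A' by blast
    then have r: "r = ?s" using D(3) rA' A' by blast
    have BCA: "B \<subseteq> C - A" using 2(6) A' disj by blast
    have "(C, r) \<notin> x"
    proof
      assume "(C, r) \<in> x"
      then have "C = A" using block_unique[OF x _ 1(1), of C r p] pt 2(6) A' by blast
      moreover have "B \<noteq> {}" using pt by blast
      ultimately show False using BCA by blast
    qed
    then show ?thesis unfolding 1(6)
    proof (rule canonical_labelI[OF 2(2) _ _ 1(1) _ mC 1(2) BCA])
      show "Min C \<le> Min C'" if "(C', r') \<in> y" "(C', r') \<notin> x" for C' r'
        using min[OF that] mC by simp
      show "A \<subseteq> C" using 2(6) A' by blast
      show "u = 0 \<and> r \<in> B" if "r \<notin> A" using that r pt 1(4) by (auto split: if_splits)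
      show "u = 1 \<and> Min B = Min (C - A)" if rA: "r \<in> A"
      proof
        show u: "u = 1" using rA r pt disj by (auto split: if_splits)
        have fin: "finite (C - A)" using finite_block[OF y 2(2)] by simp
        show "Min B = Min (C - A)"
        proof (rule Min_eqI[symmetric, OF fin])
          show "Min B \<in> C - A" using Min_block[OF x 1(2)] BCA by blast
          fix i assume i: "i \<in> C - A"
          show "Min B \<le> i"
          proof (cases "i \<in> B")
            case True
            then show ?thesis using Min_block_le[OF x 1(2)] by blast
          next
            case False
            then have "i \<in> C - A'" using i A' by blast
            then have "Min B' \<le> i" using mB' finite_block[OF y 2(2)] by simp
            then show ?thesis using u u' \<open>u' = 1\<close> by simp
          qed
        qed
      qed
    qed
  qed
qed

subsection \<open>The poset of pointed partitions\<close>

lemma merges_iff: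
  "(x, y) \<in> merges n \<longleftrightarrow> pointed_partition n x \<and> (\<exists>l. merges_with x l y)"
  using pointed_partition_merge unfolding merges_def merges_with_def by blast

text \<open>Each merge lowers the number of blocks by one, so equal cardinalities mean that nothing
  was merged. This is the source of antisymmetry.\<close>

lemma merges_rtrancl:
  assumes "(x, y) \<in> (merges n)\<^sup>*" "pointed_partition n x"
  shows "pointed_partition n y \<and> pointed_refines x y \<and> card y \<le> card x \<and> (card y = card x \<longrightarrow> x = y)"
  using assms
proof (induction rule: rtrancl_induct)
  case (step y z)
  then have y: "pointed_partition n y" and co: "pointed_refines x y"
    and c: "card y \<le> card x" by simp_all
  obtain l where l: "merges_with y l z" using step.hyps(2) by (auto simp: merges_iff)
  show ?case
    using pointed_partition_merge[OF y l] pointed_refines_trans[OF co merges_with_pointed_refines[OF y l]]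
      card_merge[OF y l] c by simp
qed (simp add: pointed_refines_refl)

lemma pointed_refines_imp_merges_rtrancl:
  assumes "pointed_partition n x" "pointed_partition n y" "pointed_refines x y"
  shows "(x, y) \<in> (merges n)\<^sup>*"
  using assms
proof (induction "card x" arbitrary: x rule: less_induct)
  case less
  show ?case
  proof (cases "x = y")
    case False
    then obtain l x' where m: "merges_with x l x'" "pointed_refines x' y"
      using ex_canonical_merge[OF less.prems] by blast
    have x': "pointed_partition n x'" using pointed_partition_merge[OF less.prems(1) m(1)] .
    have "(x', y) \<in> (merges n)\<^sup>*"
      using less.hyps[OF _ x' less.prems(2) m(2)] card_merge[OF less.prems(1) m(1)] by simp
    moreover have "(x, x') \<in> merges n" using less.prems(1) m(1) merges_iff by blast
    ultimately show ?thesis by (rule converse_rtrancl_into_rtrancl[rotated])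
  qed simp
qed

lemma pointed_partition_poset_iff:
  "(x, y) \<in> pointed_partition_poset n \<longleftrightarrow>
     pointed_partition n x \<and> pointed_partition n y \<and> pointed_refines x y"
  using merges_rtrancl pointed_refines_imp_merges_rtrancl unfolding pointed_partition_poset_def by blast

lemma pointed_partition_poset_card:
  assumes "(x, y) \<in> pointed_partition_poset n"
  shows "card y \<le> card x" "card y = card x \<Longrightarrow> x = y"
  using assms merges_rtrancl unfolding pointed_partition_poset_def by blast+

lemma Field_pointed_partition_poset: "Field (pointed_partition_poset n) = {x. pointed_partition n x}"
proof -
  have "x \<in> Field (pointed_partition_poset n)" if "pointed_partition n x" for x
    using that by (intro FieldI1[of x x]) (simp add: pointed_partition_poset_iff pointed_refines_refl)
  then show ?thesis by (auto simp: Field_def pointed_partition_poset_iff)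
qed

lemma finite_pointed_partition_poset: "finite (pointed_partition_poset n)"
proof (rule finite_subset)
  show "pointed_partition_poset n \<subseteq> {x. pointed_partition n x} \<times> {x. pointed_partition n x}"
    by (auto simp: pointed_partition_poset_iff)
qed (simp add: finite_pointed_partitions)

lemma Partial_order_pointed_partition_poset: "Partial_order (pointed_partition_poset n)"
proof (rule Partial_orderI)
  fix x y assume xy: "(x, y) \<in> pointed_partition_poset n"
  then show "(x, x) \<in> pointed_partition_poset n \<and> (y, y) \<in> pointed_partition_poset n"
    by (simp add: pointed_partition_poset_iff pointed_refines_refl)
  show "x = y" if "(y, x) \<in> pointed_partition_poset n"
    by (rule pointed_partition_poset_card(2)[OF xy antisym[OF pointed_partition_poset_card(1)[OF xy] pointed_partition_poset_card(1)[OF that]]])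
  show "(x, z) \<in> pointed_partition_poset n" if "(y, z) \<in> pointed_partition_poset n" for z
    using xy that pointed_refines_trans[of x y z] unfolding pointed_partition_poset_iff by blast
qed

lemma merge_in_pointed_partition_poset:
  assumes "pointed_partition n x" "merges_with x l y"
  shows "(x, y) \<in> pointed_partition_poset n"
  using assms pointed_partition_merge merges_with_pointed_refines
    by (simp add: pointed_partition_poset_iff)

text \<open>If \<open>y\<close> covers \<open>x\<close>, the greedy merge from \<open>x\<close>
  stays below \<open>y\<close> and must hit it. Conversely, a merge costs exactly one block, which
  leaves no intermediate element.\<close>

lemma covers_pointed_partition_poset_iff:
  "covers (pointed_partition_poset n) x y \<longleftrightarrow> pointed_partition n x \<and> (\<exists>l. merges_with x l y)"
proof
  assume c: "covers (pointed_partition_poset n) x y"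
  then have xy: "(x, y) \<in> pointed_partition_poset n" "x \<noteq> y"
    by (auto simp: covers_def less_in_def)
  then have pp: "pointed_partition n x" "pointed_partition n y" "pointed_refines x y"
    by (auto simp: pointed_partition_poset_iff)
  obtain l x' where m: "merges_with x l x'" "pointed_refines x' y"
    using ex_canonical_merge[OF pp xy(2)] by blast
  have "x \<noteq> x'" using card_merge[OF pp(1) m(1)] by auto
  then have "less_in (pointed_partition_poset n) x x'"
    using merge_in_pointed_partition_poset[OF pp(1) m(1)] by (simp add: less_in_def)
  moreover have "(x', y) \<in> pointed_partition_poset n"
    using m(2) pp pointed_partition_merge[OF pp(1) m(1)] by (simp add: pointed_partition_poset_iff)
  ultimately have "x' = y" using c unfolding covers_def less_in_def by blast
  then show "pointed_partition n x \<and> (\<exists>l. merges_with x l y)" using pp m by blast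
next
  assume "pointed_partition n x \<and> (\<exists>l. merges_with x l y)"
  then obtain l where x: "pointed_partition n x" and m: "merges_with x l y" by blast
  note c = card_merge[OF x m]
  have "x \<noteq> y" using c by auto
  then have "less_in (pointed_partition_poset n) x y"
    using merge_in_pointed_partition_poset[OF x m] by (simp add: less_in_def)
  moreover have False if "less_in (pointed_partition_poset n) x z" "less_in (pointed_partition_poset n) z y" for z
    using that pointed_partition_poset_card[of x z n] pointed_partition_poset_card[of z y n] c unfolding less_in_def by fastforce
  ultimately show "covers (pointed_partition_poset n) x y" unfolding covers_def by blast
qed

lemma covers_pointed_partition_posetE:
  assumes "covers (pointed_partition_poset n) x y"
  obtains "pointed_partition n x" "pointed_partition n y" "merges_with x (lambda_bullet x y) y"
proof -
  obtain l where x: "pointed_partition n x" and m: "merges_with x l y"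
    using assms by (auto simp: covers_pointed_partition_poset_iff)
  show thesis using that[OF x pointed_partition_merge[OF x m]] m lambda_bullet_eq[OF x m] by simp
qed

definition singletons :: "nat \<Rightarrow> pointed set" where
  "singletons n = (\<lambda>i. ({i}, i)) ` {1..n}"

lemma is_bottom_singletons: "is_bottom (pointed_partition_poset n) (singletons n)"
proof -
  have pp: "pointed_partition n (singletons n)"
  proof (rule pointed_partitionI)
    show "\<exists>A p. (A, p) \<in> singletons n \<and> i \<in> A" if "i \<in> {1..n}" for i
      unfolding singletons_def using that by (intro exI[of _ "{i}"] exI[of _ i]) simp
  qed (auto simp: singletons_def)
  have "pointed_refines (singletons n) x" if x: "pointed_partition n x" for x
    unfolding pointed_refines_def
  proof (rule ballI, rule case_prodI2)
    fix X A p assume "X \<in> singletons n" "X = (A, p)"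
    then have "A = {p}" "p \<in> {1..n}" by (auto simp: singletons_def)
    then obtain C r where "(C, r) \<in> x" "p \<in> C" using ex_block[OF x] by blast
    then show "\<exists>(C, r)\<in>x. A \<subseteq> C \<and> (r \<in> A \<longrightarrow> r = p)" using \<open>A = {p}\<close> by blast
  qed
  then show ?thesis using pp
    by (simp add: is_bottom_def Field_pointed_partition_poset pointed_partition_poset_iff)
qed

lemma card_singletons: "card (singletons n) = n"
  unfolding singletons_def by (subst card_image) (auto simp: inj_on_def)

lemma is_rank_function_pointed_partition_poset: "is_rank_function (pointed_partition_poset n) (\<lambda>x. n - card x)"
  unfolding is_rank_function_def bottom_eqI[OF Partial_order_pointed_partition_poset is_bottom_singletons]
proof (intro conjI allI impI)
  show "n - card (singletons n) = 0" by (simp add: card_singletons)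
  fix x y assume "covers (pointed_partition_poset n) x y"
  then obtain l where x: "pointed_partition n x" and m: "merges_with x l y"
    by (auto simp: covers_pointed_partition_poset_iff)
  \<comment> \<open>Being above the bottom gives \<open>card x \<le> n\<close>, without which the
    truncated subtraction could lose the step.\<close>
  have "(singletons n, x) \<in> pointed_partition_poset n"
    using x is_bottom_singletons[of n] by (simp add: is_bottom_def Field_pointed_partition_poset)
  then have "card x \<le> n" using pointed_partition_poset_card(1) card_singletons by metis
  then show "n - card y = Suc (n - card x)" using card_merge[OF x m] by simp
qed

lemma graded_pointed_partition_poset: "graded_poset (pointed_partition_poset n)"
  unfolding graded_poset_def
  using finite_pointed_partition_poset Partial_order_pointed_partition_poset is_bottom_singletons is_rank_function_pointed_partition_poset by blast

subsection \<open>The poset of labels\<close>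

lemma Field_ordinal_sum: "Field (ordinal_sum R S) = Field R \<union> Field S"
  by (auto simp: ordinal_sum_def Field_def)

lemma in_label_antichain:
  "((a, b, u), (c, d, v)) \<in> label_antichain n k \<longleftrightarrow>
     a = k \<and> c = k \<and> u = 0 \<and> v = 0 \<and> b = d \<and> k < b \<and> b \<le> n"
  by (auto simp: label_antichain_def)

lemma in_label_chain:
  "((a, b, u), (c, d, v)) \<in> label_chain n k \<longleftrightarrow>
     a = k \<and> c = k \<and> u = 1 \<and> v = 1 \<and> k < b \<and> b \<le> d \<and> d \<le> n"
  by (auto simp: label_chain_def)

lemma in_Field_label_antichain:
  "(a, b, u) \<in> Field (label_antichain n k) \<longleftrightarrow> a = k \<and> u = 0 \<and> k < b \<and> b \<le> n"
  by (auto simp: Field_def label_antichain_def)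

lemma in_Field_label_chain:
  "(a, b, u) \<in> Field (label_chain n k) \<longleftrightarrow> a = k \<and> u = 1 \<and> k < b \<and> b \<le> n"
  by (auto simp: Field_def label_chain_def)

definition valid_label :: "nat \<Rightarrow> nat \<Rightarrow> label \<Rightarrow> bool" where
  "valid_label n k = (\<lambda>(a, b, u). k \<le> a \<and> a < b \<and> b \<le> n \<and> u \<in> {0, 1})"

text \<open>Generalised to an arbitrary lower index \<open>k\<close> for a downward induction that
  peels off one antichain and one chain; at \<open>k = n\<close> no label is valid and both sides
  are empty.\<close>

lemma foldr_ordinal_sum:
  assumes "k \<le> n"
  shows "foldr ordinal_sum (concat (map (\<lambda>a. [label_antichain n a, label_chain n a]) [k..<n])) {}
    = {(l, l'). valid_label n k l \<and> valid_label n k l' \<and> (l = l' \<or> label_less l l')}"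
    (is "?L k = ?R k")
  using assms
proof (induction rule: inc_induct)
  case base
  then show ?case by (auto simp: valid_label_def)
next
  case (step k)
  have FR: "Field (?R (Suc k)) = {l. valid_label n (Suc k) l}" by (auto simp: Field_def)
  have "?L k = ordinal_sum (label_antichain n k) (ordinal_sum (label_chain n k) (?R (Suc k)))"
    using step by (simp add: upt_conv_Cons)
  also have "\<dots> = label_antichain n k \<union> label_chain n k \<union> ?R (Suc k)
      \<union> Field (label_chain n k) \<times> {l. valid_label n (Suc k) l}
      \<union> Field (label_antichain n k) \<times> (Field (label_chain n k) \<union> {l. valid_label n (Suc k) l})"
    unfolding ordinal_sum_def[of "label_antichain n k"] Field_ordinal_sum FR
    unfolding ordinal_sum_def FR by blast
  also have "\<dots> = ?R k"
  proof (rule set_eqI)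
    fix z :: "label \<times> label"
    obtain a b u c d v where z: "z = ((a, b, u), (c, d, v))" by (metis prod.exhaust)
    show "z \<in> label_antichain n k \<union> label_chain n k \<union> ?R (Suc k)
      \<union> Field (label_chain n k) \<times> {l. valid_label n (Suc k) l}
      \<union> Field (label_antichain n k) \<times> (Field (label_chain n k) \<union> {l. valid_label n (Suc k) l})
      \<longleftrightarrow> z \<in> ?R k"
      unfolding z
      by (simp add: in_label_antichain in_label_chain in_Field_label_antichain in_Field_label_chain
          valid_label_def del: One_nat_def) (cases "a = k"; cases "c = k"; auto)
  qed
  finally show ?case .
qed

lemma label_poset_eq:
  assumes "n \<ge> 1"
  shows "label_poset n = {(l, l'). valid_label n 1 l \<and> valid_label n 1 l' \<and> (l = l' \<or> label_less l l')}"
  unfolding label_poset_def using foldr_ordinal_sum[of 1 n] assms by simp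

lemma label_less_irrefl: "\<not> label_less l l"
  by (cases l) auto

lemma label_less_trans: "label_less l l' \<Longrightarrow> label_less l' l'' \<Longrightarrow> label_less l l''"
  by (cases l; cases l'; cases l'') auto

lemma less_in_label_poset:
  assumes "n \<ge> 1"
  shows "less_in (label_poset n) l l' \<longleftrightarrow> valid_label n 1 l \<and> valid_label n 1 l' \<and> label_less l l'"
  using label_less_irrefl[of l] by (auto simp: label_poset_eq[OF assms] less_in_def)

lemma Partial_order_label_poset:
  assumes "n \<ge> 1"
  shows "Partial_order (label_poset n)"
  by (rule Partial_orderI)
    (auto simp: label_poset_eq[OF assms] label_less_irrefl dest: label_less_trans)

lemma valid_label_merge:
  assumes x: "pointed_partition n x" and m: "merges_with x l y"
  shows "valid_label n 1 l"
  using m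
proof (rule merges_withE)
  fix u A p B q
  assume A: "(A, p) \<in> x" and B: "(B, q) \<in> x" and lt: "Min A < Min B" "u \<in> {0, 1::nat}"
    and l: "l = (Min A, Min B, u)"
  have "Min A \<in> {1..n}" "Min B \<in> {1..n}"
    using Min_block[OF x] block_subset[OF x] A B by blast+
  then show ?thesis using lt l by (auto simp: valid_label_def)
qed

lemma less_in_label_poset_merges:
  assumes "n \<ge> 1" "pointed_partition n x" "merges_with x l y" "pointed_partition n x'" "merges_with x' l' y'"
  shows "less_in (label_poset n) l l' \<longleftrightarrow> label_less l l'"
  using assms valid_label_merge by (simp add: less_in_label_poset)

lemma edge_labeling_lambda_bullet:
  assumes "n \<ge> 1"
  shows "edge_labeling (pointed_partition_poset n) (label_poset n) lambda_bullet"
  unfolding edge_labeling_def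
proof (intro conjI allI impI)
  show "graded_poset (pointed_partition_poset n)" by (rule graded_pointed_partition_poset)
  show "Partial_order (label_poset n)" using assms by (rule Partial_order_label_poset)
  fix x y assume "covers (pointed_partition_poset n) x y"
  then have "valid_label n 1 (lambda_bullet x y)"
    by (rule covers_pointed_partition_posetE) (rule valid_label_merge)
  then show "lambda_bullet x y \<in> Field (label_poset n)"
    by (intro FieldI1[of _ "lambda_bullet x y"]) (simp add: label_poset_eq[OF assms])
qed

subsection \<open>Maximal chains\<close>

lemma labels_simps [simp]:
  "labels lab [x] = []"
  "labels lab (x # y # c) = lab x y # labels lab (y # c)"
  by (simp_all add: labels_def)

lemma singleton_max_chain [simp]: "[x] \<in> max_chains P z y \<longleftrightarrow> x = z \<and> x = y \<and> x \<in> Field P"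
  by (auto simp: max_chains_def)

lemma Cons_max_chain [simp]:
  "x # x' # c \<in> max_chains P z y \<longleftrightarrow> x = z \<and> covers P x x' \<and> x' # c \<in> max_chains P x' y"
  by (auto simp: max_chains_def covers_def less_in_def Field_def)

lemma max_chain_in_poset:
  assumes "Partial_order P" "c \<in> max_chains P x y"
  shows "(x, y) \<in> P \<and> (x = y \<longleftrightarrow> c = [x])"
  using assms(2)
proof (induction c arbitrary: x rule: induct_list012)
  case 1
  then show ?case by (simp add: max_chains_def)
next
  case (2 x')
  then show ?case using Partial_orderD(1)[OF assms(1), of x] by auto
next
  case (3 v x' c)
  have v: "v = x" and c: "covers P x x'" and m: "x' # c \<in> max_chains P x' y"
    using "3.prems" by auto
  have IH: "(x', y) \<in> P" using "3.IH"(2)[OF m] by simp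
  from c have "(x, x') \<in> P" "x \<noteq> x'" by (simp_all add: covers_def less_in_def)
  then show ?case
    using IH v Partial_orderD(2)[OF assms(1), of x x' y] Partial_orderD(3)[OF assms(1), of x x'] by auto
qed

lemma max_chain_shape:
  assumes "c \<in> max_chains P x y"
  obtains "c = [x]" "x = y" | x' c' where "c = x # x' # c'"
proof (cases c)
  case Nil
  then show thesis using assms by (simp add: max_chains_def)
next
  case (Cons v d)
  then have "v = x" using assms by (simp add: max_chains_def)
  then show thesis using assms Cons that by (cases d) auto
qed

section \<open>Increasing chains\<close>

lemma increasing_chain_simps [simp]:
  "increasing_chain L lab [x]"
  "increasing_chain L lab [x, y]"
  "increasing_chain L lab (x # y # z # c) \<longleftrightarrow>
     less_in L (lab x y) (lab y z) \<and> increasing_chain L lab (y # z # c)"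
  by (simp_all add: increasing_chain_def)

lemma increasing_chain_tl:
  assumes "increasing_chain L lab (x # y # c)"
  shows "increasing_chain L lab (y # c)"
  using assms by (cases c) auto

lemma max_chain_pointed_refines:
  assumes "c \<in> max_chains (pointed_partition_poset n) x y"
  shows "pointed_partition n y" "pointed_refines x y" "x = y \<longleftrightarrow> c = [x]"
  using max_chain_in_poset[OF Partial_order_pointed_partition_poset assms]
    by (auto simp: pointed_partition_poset_iff)

text \<open>A single merge is canonical, and each ascent passes canonicity one step towards the
  start.\<close>

lemma increasing_chain_first_label:
  assumes n: "n \<ge> 1"
    and "x # x' # c \<in> max_chains (pointed_partition_poset n) x y"
    and "increasing_chain (label_poset n) lambda_bullet (x # x' # c)"
  shows "canonical_label x y (lambda_bullet x x')"
  using assms(2,3)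
proof (induction c arbitrary: x x')
  case Nil
  then have cov: "covers (pointed_partition_poset n) x y" and "x' = y" by auto
  from cov have "canonical_label x y (lambda_bullet x y)"
    by (rule covers_pointed_partition_posetE) (rule canonical_label_single_merge)
  then show ?case using \<open>x' = y\<close> by simp
next
  case (Cons x'' c)
  from Cons.prems(1) have cov: "covers (pointed_partition_poset n) x x'" "covers (pointed_partition_poset n) x' x''"
    and mc: "x' # x'' # c \<in> max_chains (pointed_partition_poset n) x' y" by auto
  from cov(1) have 1: "pointed_partition n x" "merges_with x (lambda_bullet x x') x'"
    by (auto elim: covers_pointed_partition_posetE)
  from cov(2) have 2: "pointed_partition n x'" "merges_with x' (lambda_bullet x' x'') x''"
    by (auto elim: covers_pointed_partition_posetE)
  have "label_less (lambda_bullet x x') (lambda_bullet x' x'')"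
    using Cons.prems(2) less_in_label_poset_merges[OF n 1 2] by simp
  moreover have "canonical_label x' y (lambda_bullet x' x'')"
    using Cons.IH[OF mc increasing_chain_tl[OF Cons.prems(2)]] .
  ultimately show ?case
    using canonical_label_extend[OF 1(1) max_chain_pointed_refines(1)[OF mc] 1(2) max_chain_pointed_refines(2)[OF mc]]
    by blast
qed

lemma increasing_chain_unique:
  assumes n: "n \<ge> 1"
    and "c \<in> max_chains (pointed_partition_poset n) x y" "d \<in> max_chains (pointed_partition_poset n) x y"
    and "increasing_chain (label_poset n) lambda_bullet c" "increasing_chain (label_poset n) lambda_bullet d"
  shows "c = d"
  using assms(2-)
proof (induction c arbitrary: x d)
  case Nil
  then show ?case by (simp add: max_chains_def)
next
  case (Cons v c)
  have y: "pointed_partition n y" using max_chain_pointed_refines(1)[OF Cons.prems(1)] .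
  show ?case
  proof (cases "x = y")
    case True
    then show ?thesis
      using max_chain_pointed_refines(3)[OF Cons.prems(1)] max_chain_pointed_refines(3)[OF Cons.prems(2)] by simp
  next
    case False
    obtain x' c' where c: "v # c = x # x' # c'"
      using max_chain_shape[OF Cons.prems(1)] False by blast
    obtain x'' d' where d: "d = x # x'' # d'"
      using max_chain_shape[OF Cons.prems(2)] False by blast
    from Cons.prems(1) c have cov1: "covers (pointed_partition_poset n) x x'"
      and mc: "c \<in> max_chains (pointed_partition_poset n) x' y" by auto
    from Cons.prems(2) d have cov2: "covers (pointed_partition_poset n) x x''"
      and md: "x'' # d' \<in> max_chains (pointed_partition_poset n) x'' y" by auto
    from cov1 have x: "pointed_partition n x" and m1: "merges_with x (lambda_bullet x x') x'"
      by (auto elim: covers_pointed_partition_posetE)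
    from cov2 have m2: "merges_with x (lambda_bullet x x'') x''"
      by (auto elim: covers_pointed_partition_posetE)
    have "lambda_bullet x x' = lambda_bullet x x''"
      using canonical_label_unique[OF x y]
        increasing_chain_first_label[OF n Cons.prems(1)[unfolded c] Cons.prems(3)[unfolded c]]
        increasing_chain_first_label[OF n Cons.prems(2)[unfolded d] Cons.prems(4)[unfolded d]] by blast
    then have eq: "x' = x''" using merges_with_functional[OF x m1] m2 by simp
    have "c = x'' # d'"
    proof (rule Cons.IH)
      show "c \<in> max_chains (pointed_partition_poset n) x' y" by (rule mc)
      show "x'' # d' \<in> max_chains (pointed_partition_poset n) x' y" using md eq by simp
      show "increasing_chain (label_poset n) lambda_bullet c"
        using Cons.prems(3) c increasing_chain_tl by auto
      show "increasing_chain (label_poset n) lambda_bullet (x'' # d')"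
        using Cons.prems(4) d increasing_chain_tl by auto
    qed
    then show ?thesis using c d by simp
  qed
qed

text \<open>The greedy merge is put in front of an increasing chain given by induction. That chain
  begins with a canonical label, which is what makes the new junction an ascent.\<close>

lemma ex_increasing_chain:
  assumes n: "n \<ge> 1" and "pointed_partition n x" "pointed_partition n y" "pointed_refines x y"
  shows "\<exists>c. c \<in> max_chains (pointed_partition_poset n) x y \<and> increasing_chain (label_poset n) lambda_bullet c"
  using assms(2-)
proof (induction "card x" arbitrary: x rule: less_induct)
  case less
  show ?case
  proof (cases "x = y")
    case True
    then have "[x] \<in> max_chains (pointed_partition_poset n) x y"
      using less.prems(1) by (simp add: Field_pointed_partition_poset)
    then show ?thesis by (intro exI[of _ "[x]"]) (simp del: singleton_max_chain)
  next
    case False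
    then obtain l x' where m: "merges_with x l x'" "canonical_label x y l" "pointed_refines x' y"
      using ex_canonical_merge[OF less.prems] by blast
    have x': "pointed_partition n x'" using pointed_partition_merge[OF less.prems(1) m(1)] .
    obtain c where c: "c \<in> max_chains (pointed_partition_poset n) x' y"
      "increasing_chain (label_poset n) lambda_bullet c"
      using less.hyps[OF _ x' less.prems(2) m(3)] card_merge[OF less.prems(1) m(1)] by (metis lessI)
    have cov: "covers (pointed_partition_poset n) x x'"
      using less.prems(1) m(1) covers_pointed_partition_poset_iff by blast
    have l: "lambda_bullet x x' = l" using lambda_bullet_eq[OF less.prems(1) m(1)] .
    show ?thesis
    proof (cases rule: max_chain_shape[OF c(1)])
      case 1
      then have "[x, x'] \<in> max_chains (pointed_partition_poset n) x y"
        using cov x' by (simp add: Field_pointed_partition_poset)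
      then show ?thesis by (intro exI[of _ "[x, x']"]) (simp del: singleton_max_chain Cons_max_chain)
    next
      case (2 x'' c')
      have "covers (pointed_partition_poset n) x' x''" using c(1) 2 by simp
      then have m': "merges_with x' (lambda_bullet x' x'') x''" by (rule covers_pointed_partition_posetE)
      have "canonical_label x' y (lambda_bullet x' x'')"
        using increasing_chain_first_label[OF n] c 2 by blast
      then have "label_less l (lambda_bullet x' x'')"
        using canonical_labels_increase[OF less.prems(1,2) m(1,2)] by blast
      then have "increasing_chain (label_poset n) lambda_bullet (x # c)"
        using c(2) less_in_label_poset_merges[OF n less.prems(1) m(1) x' m'] l 2 by simp
      moreover have "x # c \<in> max_chains (pointed_partition_poset n) x y" using c(1) cov 2 by simp
      ultimately show ?thesis by blast
    qed
  qed
qed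

lemma ER_labeling_lambda_bullet:
  assumes "n \<ge> 1"
  shows "ER_labeling (pointed_partition_poset n) (label_poset n) lambda_bullet"
  unfolding ER_labeling_def
proof (intro conjI allI impI)
  show "edge_labeling (pointed_partition_poset n) (label_poset n) lambda_bullet"
    using assms by (rule edge_labeling_lambda_bullet)
  fix x y assume "(x, y) \<in> pointed_partition_poset n"
  then have "pointed_partition n x" "pointed_partition n y" "pointed_refines x y"
    by (simp_all add: pointed_partition_poset_iff)
  then obtain c where "c \<in> max_chains (pointed_partition_poset n) x y \<and>
      increasing_chain (label_poset n) lambda_bullet c"
    using ex_increasing_chain[OF assms] by blast
  then show "\<exists>!c. c \<in> max_chains (pointed_partition_poset n) x y \<and>
      increasing_chain (label_poset n) lambda_bullet c"
    using increasing_chain_unique[OF assms] by (intro ex1I[of _ c]) blast+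
qed

text \<open>Serves twice: it gives the third EW condition, and in the second one the uniqueness of
  the switched chain.\<close>

lemma max_chain_determined_by_labels:
  assumes "c \<in> max_chains (pointed_partition_poset n) x y" "d \<in> max_chains (pointed_partition_poset n) x y"
    and "labels lambda_bullet c = labels lambda_bullet d"
  shows "c = d"
  using assms
proof (induction c arbitrary: x d)
  case Nil
  then show ?case by (simp add: max_chains_def)
next
  case (Cons v c)
  show ?case
  proof (cases "x = y")
    case True
    then show ?thesis
      using max_chain_pointed_refines(3)[OF Cons.prems(1)] max_chain_pointed_refines(3)[OF Cons.prems(2)] by simp
  next
    case False
    obtain x' c' where c: "v # c = x # x' # c'"
      using max_chain_shape[OF Cons.prems(1)] False by blast
    obtain x'' d' where d: "d = x # x'' # d'"
      using max_chain_shape[OF Cons.prems(2)] False by blast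
    from Cons.prems(1) c have cov1: "covers (pointed_partition_poset n) x x'"
      and mc: "c \<in> max_chains (pointed_partition_poset n) x' y" by auto
    from Cons.prems(2) d have cov2: "covers (pointed_partition_poset n) x x''"
      and md: "x'' # d' \<in> max_chains (pointed_partition_poset n) x'' y" by auto
    from cov1 have x: "pointed_partition n x" and m1: "merges_with x (lambda_bullet x x') x'"
      by (auto elim: covers_pointed_partition_posetE)
    from cov2 have m2: "merges_with x (lambda_bullet x x'') x''"
      by (auto elim: covers_pointed_partition_posetE)
    have lab: "lambda_bullet x x' = lambda_bullet x x''"
      "labels lambda_bullet c = labels lambda_bullet (x'' # d')"
      using Cons.prems(3) c d by auto
    then have "x' = x''" using merges_with_functional[OF x m1] m2 by simp
    then have "c = x'' # d'" using Cons.IH[OF mc _ lab(2)] md by simp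
    then show ?thesis using c d by simp
  qed
qed

lemma ascent_free_injective_lambda_bullet:
  "ascent_free_injective (pointed_partition_poset n) (label_poset n) lambda_bullet"
  unfolding ascent_free_injective_def
  using max_chain_determined_by_labels by (auto intro!: inj_onI)

subsection \<open>Rank two switching\<close>

text \<open>Set-level interchange of two merges neither of which consumes the block created by the
  other.\<close>

lemma insert_Diff_commute:
  assumes "a \<notin> T" "b \<notin> S"
  shows "insert b (insert a (X - S) - T) = insert a (insert b (X - T) - S)"
  using assms by blast

text \<open>An ascent gives \<open>Min A \<le> Min C < Min D\<close>, so \<open>D\<close> is an old
  block and only \<open>C\<close> can be the merged one. If it is, the second merge is a
  \<open>1\<close>-merge and \<open>D\<close> may be absorbed into \<open>A\<close> ahead of
  \<open>B\<close>; otherwise the two merges do not touch each other.\<close>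

lemma merges_switch:
  assumes x: "pointed_partition n x" and m: "merges_with x l x'" and m': "merges_with x' l' y"
    and less: "label_less l l'"
  obtains x'' where "merges_with x l' x''" "merges_with x'' l y"
proof -
  from m obtain u A p B q where 1: "(A, p) \<in> x" "(B, q) \<in> x" "Min A < Min B" "u \<in> {0, 1}"
    "x' = insert (A \<union> B, if u = 1 then p else q) (x - {(A, p), (B, q)})" "l = (Min A, Min B, u)"
    by (rule merges_withE)
  from m' obtain v C r D s where 2: "(C, r) \<in> x'" "(D, s) \<in> x'" "Min C < Min D" "v \<in> {0, 1}"
    "y = insert (C \<union> D, if v = 1 then r else s) (x' - {(C, r), (D, s)})" "l' = (Min C, Min D, v)"
    by (rule merges_withE)
  let ?t = "if u = 1 then p else q"
  have x': "pointed_partition n x'" using pointed_partition_merge[OF x m] .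
  have mAB: "Min (A \<union> B) = Min A" using Min_Un_blocks[OF x 1(1-3)] .
  have AB: "(A \<union> B, ?t) \<in> x'" "(A \<union> B, w) \<notin> x" for w
    using Un_block_not_in[OF x 1(1-3)] unfolding 1(5) by simp_all
  have nAB: "(E, w) \<in> x \<and> (E, w) \<notin> {(A, p), (B, q)}" if "(E, w) \<in> x'" "Min E \<noteq> Min A" for E w
  proof -
    have "(E, w) \<noteq> (A \<union> B, ?t)" using that(2) mAB by auto
    then show ?thesis using that(1) unfolding 1(5) by blast
  qed
  have le: "Min A \<le> Min C" using less 1(6) 2(6) by auto
  then have D: "(D, s) \<in> x" "(D, s) \<notin> {(A, p), (B, q)}" using nAB[OF 2(2)] 2(3) by auto
  show thesis
  proof (cases "Min A = Min C")
    case True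
    then have "C = A \<union> B" "r = ?t" using Min_block_inj[OF x' 2(1) AB(1)] mAB by simp_all
    have uv: "v = 1" "u = 0 \<or> u = 1" using less 1(4,6) 2(4,6) True by auto
    have AD: "Min A < Min D" using True 2(3) by simp
    have nAD: "(A \<union> D, w) \<notin> x" for w using Un_block_not_in[OF x 1(1) D(1) AD] .
    \<comment> \<open>As \<open>v = 1\<close>, the point \<open>p\<close> survives the early
      absorption of \<open>D\<close>, so the later merge with \<open>B\<close> still chooses between
      \<open>p\<close> and \<open>q\<close>.\<close>
    let ?x'' = "insert (A \<union> D, p) (x - {(A, p), (D, s)})"
    have m1: "merges_with x l' ?x''"
      by (rule merges_withI[OF 1(1) D(1) AD 2(4)]) (simp_all add: uv 2(6) True)
    have "merges_with ?x'' l y"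
    proof (rule merges_withI)
      show "(A \<union> D, p) \<in> ?x''" by simp
      show "(B, q) \<in> ?x''" using 1(1-3) D(2) by auto
      show "Min (A \<union> D) < Min B" "l = (Min (A \<union> D), Min B, u)"
        using Min_Un_blocks[OF x 1(1) D(1) AD] 1(3,6) by simp_all
      have "y = insert (A \<union> B \<union> D, ?t) (x - {(A, p), (B, q), (D, s)})"
        unfolding 2(5) \<open>C = A \<union> B\<close> \<open>r = ?t\<close> 1(5) using AB(2) uv by auto
      also have "\<dots> = insert (A \<union> D \<union> B, ?t) (?x'' - {(A \<union> D, p), (B, q)})"
        using nAD by (auto simp: Un_ac)
      finally show "y = insert (A \<union> D \<union> B, ?t) (?x'' - {(A \<union> D, p), (B, q)})" .
    qed (rule 1(4))
    then show thesis using that m1 by blast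
  next
    case False
    then have C: "(C, r) \<in> x" "(C, r) \<notin> {(A, p), (B, q)}" using nAB[OF 2(1)] by auto
    have nCD: "(C \<union> D, w) \<notin> x" for w using Un_block_not_in[OF x C(1) D(1) 2(3)] .
    let ?w = "if v = 1 then r else s"
    let ?x'' = "insert (C \<union> D, ?w) (x - {(C, r), (D, s)})"
    have m1: "merges_with x l' ?x''"
      by (rule merges_withI[OF C(1) D(1) 2(3,4)]) (simp_all add: 2(6))
    have "merges_with ?x'' l y"
    proof (rule merges_withI[OF _ _ 1(3,4) _ 1(6)])
      show "(A, p) \<in> ?x''" "(B, q) \<in> ?x''" using 1(1,2) C(2) D(2) by auto
      have ne: "(A \<union> B, ?t) \<notin> {(C, r), (D, s)}" "(C \<union> D, ?w) \<notin> {(A, p), (B, q)}"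
        using AB(2) nCD C(1) D(1) 1(1,2) by auto
      show "y = insert (A \<union> B, ?t) (?x'' - {(A, p), (B, q)})"
        unfolding 2(5) 1(5) using ne by (rule insert_Diff_commute)
    qed
    then show thesis using that m1 by blast
  qed
qed

lemma rank_two_switching_lambda_bullet:
  assumes n: "n \<ge> 1"
  shows "rank_two_switching (pointed_partition_poset n) (label_poset n) lambda_bullet"
  unfolding rank_two_switching_def
proof (intro allI impI, elim conjE)
  fix x y c a b
  assume c: "c \<in> max_chains (pointed_partition_poset n) x y"
    and inc: "increasing_chain (label_poset n) lambda_bullet c"
    and lab: "labels lambda_bullet c = [a, b]"
  obtain x' z c' where "c = x # x' # z # c'"
    using max_chain_shape[OF c] lab by (metis labels_simps list.distinct(1) list.inject list.exhaust)
  moreover have "c' = []" using lab calculation by (cases c') auto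
  ultimately have c_eq: "c = [x, x', y]" using c by auto
  have cov: "covers (pointed_partition_poset n) x x'" "covers (pointed_partition_poset n) x' y"
    using c c_eq by auto
  have ab: "lambda_bullet x x' = a" "lambda_bullet x' y = b" using lab c_eq by auto
  from cov(1) have 1: "pointed_partition n x" "merges_with x a x'"
    using ab by (auto elim: covers_pointed_partition_posetE)
  from cov(2) have 2: "pointed_partition n x'" "merges_with x' b y" and y: "pointed_partition n y"
    using ab by (auto elim: covers_pointed_partition_posetE)
  have "label_less a b" using inc c_eq ab less_in_label_poset_merges[OF n 1 2] by simp
  then obtain x'' where m: "merges_with x b x''" "merges_with x'' a y"
    using merges_switch[OF 1(1,2) 2(2)] by blast
  have x'': "pointed_partition n x''" using pointed_partition_merge[OF 1(1) m(1)] .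
  let ?d = "[x, x'', y]"
  have "covers (pointed_partition_poset n) x x''" "covers (pointed_partition_poset n) x'' y"
    using m 1(1) x'' by (simp_all add: covers_pointed_partition_poset_iff del: split_paired_Ex) blast+
  then have d: "?d \<in> max_chains (pointed_partition_poset n) x y"
    using y by (simp add: Field_pointed_partition_poset)
  moreover have "labels lambda_bullet ?d = [b, a]"
    using lambda_bullet_eq[OF 1(1) m(1)] lambda_bullet_eq[OF x'' m(2)] by simp
  ultimately show "\<exists>!d. d \<in> max_chains (pointed_partition_poset n) x y \<and> labels lambda_bullet d = [b, a]"
    using max_chain_determined_by_labels by (intro ex1I[of _ ?d]) auto
qed

lemma EW_labeling_lambda_bullet:
  assumes "n \<ge> 1"
  shows "EW_labeling (pointed_partition_poset n) (label_poset n) lambda_bullet"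
  unfolding EW_labeling_def
  using assms ER_labeling_lambda_bullet rank_two_switching_lambda_bullet ascent_free_injective_lambda_bullet
  by blast

section \<open>Rooted forests\<close>

text \<open>A forest is its set of edges \<open>(v, parent of v)\<close>; its roots are the vertices outside the domain.\<close>

definition rooted_forest :: "nat \<Rightarrow> nat rel \<Rightarrow> bool" where
  "rooted_forest n F \<longleftrightarrow> F \<subseteq> {1..n} \<times> {1..n} \<and> single_valued F \<and> acyclic F"

text \<open>
  The covers hang a root below another root.  So below \<open>G\<close> one finds the edge sets
  that contain, with an edge, all edges of \<open>G\<close> further down: a distributive lattice of order ideals.
\<close>

definition forest_poset :: "nat \<Rightarrow> nat rel rel" where
  "forest_poset n =
     {(F, G). rooted_forest n G \<and> F \<subseteq> G \<and> (\<forall>(v, w)\<in>G. w \<in> Domain F \<longrightarrow> (v, w) \<in> F)}"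

lemma rooted_forest_subset:
  assumes "rooted_forest n G" "F \<subseteq> G"
  shows "rooted_forest n F"
  using assms single_valued_subset[OF assms(2)] acyclic_subset[OF _ assms(2)]
  unfolding rooted_forest_def by blast

lemma rooted_forest_empty: "rooted_forest n {}"
  by (simp add: rooted_forest_def acyclic_def)

lemma finite_rooted_forest:
  assumes "rooted_forest n F"
  shows "finite F"
  using assms unfolding rooted_forest_def by (meson finite_SigmaI finite_atLeastAtMost finite_subset)

lemma finite_rooted_forests: "finite {F. rooted_forest n F}"
  by (rule finite_subset[of _ "Pow ({1..n} \<times> {1..n})"]) (auto simp: rooted_forest_def)

lemma forest_poset_iff:
  "(F, G) \<in> forest_poset n \<longleftrightarrow>
     rooted_forest n F \<and> rooted_forest n G \<and> F \<subseteq> G \<and>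
     (\<forall>v w. (v, w) \<in> G \<longrightarrow> w \<in> Domain F \<longrightarrow> (v, w) \<in> F)"
  using rooted_forest_subset[of n G F] by (auto simp: forest_poset_def)

lemma Field_forest_poset: "Field (forest_poset n) = {F. rooted_forest n F}"
proof -
  have "F \<in> Field (forest_poset n)" if "rooted_forest n F" for F
    using that by (intro FieldI1[of F F]) (simp add: forest_poset_iff)
  then show ?thesis by (auto simp: Field_def forest_poset_iff)
qed

lemma finite_forest_poset: "finite (forest_poset n)"
proof (rule finite_subset)
  show "forest_poset n \<subseteq> {F. rooted_forest n F} \<times> {F. rooted_forest n F}"
    by (auto simp: forest_poset_iff)
qed (simp add: finite_rooted_forests)

lemma Partial_order_forest_poset: "Partial_order (forest_poset n)"
proof (rule Partial_orderI)
  fix F G assume FG: "(F, G) \<in> forest_poset n"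
  then show "(F, F) \<in> forest_poset n \<and> (G, G) \<in> forest_poset n"
    by (simp add: forest_poset_iff)
  show "F = G" if "(G, F) \<in> forest_poset n"
    using FG that unfolding forest_poset_iff by (elim conjE) (rule equalityI)
  show "(F, H) \<in> forest_poset n" if GH: "(G, H) \<in> forest_poset n" for H
    unfolding forest_poset_iff
  proof (intro conjI allI impI)
    show "rooted_forest n F" "rooted_forest n H" using FG GH by (simp_all add: forest_poset_iff)
    have sub: "F \<subseteq> G" "G \<subseteq> H" using FG GH by (simp_all add: forest_poset_iff)
    then show "F \<subseteq> H" by simp
    fix v w assume vw: "(v, w) \<in> H" "w \<in> Domain F"
    then have "w \<in> Domain G" using sub by blast
    then have "(v, w) \<in> G" using vw GH by (simp add: forest_poset_iff)
    then show "(v, w) \<in> F" using vw FG by (simp add: forest_poset_iff)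
  qed
qed

lemma is_bottom_forest_poset: "is_bottom (forest_poset n) {}"
  by (simp add: is_bottom_def Field_forest_poset forest_poset_iff rooted_forest_empty)

text \<open>Among the edges of \<open>G\<close> missing in \<open>F\<close>, one with lowest tail
  \<open>v\<close> can be added: all edges of \<open>G\<close> into \<open>v\<close> are already in
  \<open>F\<close>, and its head is still a root of \<open>F\<close> by the ideal condition.\<close>

lemma ex_forest_between:
  assumes FG: "(F, G) \<in> forest_poset n" and ne: "F \<noteq> G"
  obtains e where "e \<notin> F" "(F, insert e F) \<in> forest_poset n" "(insert e F, G) \<in> forest_poset n"
proof -
  have F: "rooted_forest n F" and G: "rooted_forest n G" and sub: "F \<subseteq> G"
    and ideal: "\<And>v w. (v, w) \<in> G \<Longrightarrow> w \<in> Domain F \<Longrightarrow> (v, w) \<in> F"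
    using FG by (simp_all add: forest_poset_iff)
  have "wf G" using finite_acyclic_wf[OF finite_rooted_forest[OF G]] G by (simp add: rooted_forest_def)
  moreover have "Domain (G - F) \<noteq> {}" using sub ne by auto
  then obtain v0 where "v0 \<in> Domain (G - F)" by blast
  ultimately obtain v where v: "v \<in> Domain (G - F)"
    and min: "\<And>y. (y, v) \<in> G \<Longrightarrow> y \<notin> Domain (G - F)"
    using wfE_min by metis
  then obtain w where vw: "(v, w) \<in> G" "(v, w) \<notin> F" by blast
  have w: "w \<notin> Domain F" using ideal vw by blast
  have F': "rooted_forest n (insert (v, w) F)" using rooted_forest_subset[OF G] vw sub by simp
  have min': "(y, v) \<in> F" if "(y, v) \<in> G" for y using min[OF that] that by blast
  show thesis
  proof (rule that[OF vw(2)])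
    show "(F, insert (v, w) F) \<in> forest_poset n"
      using F F' w by (auto simp: forest_poset_iff)
    show "(insert (v, w) F, G) \<in> forest_poset n"
      unfolding forest_poset_iff using F' G sub vw min' ideal by blast
  qed
qed

lemma is_rank_function_forest_poset: "is_rank_function (forest_poset n) card"
  unfolding is_rank_function_def bottom_eqI[OF Partial_order_forest_poset is_bottom_forest_poset]
proof (intro conjI allI impI)
  fix F G assume c: "covers (forest_poset n) F G"
  then have FG: "(F, G) \<in> forest_poset n" "F \<noteq> G" by (auto simp: covers_def less_in_def)
  then obtain e where e: "e \<notin> F" "(F, insert e F) \<in> forest_poset n" "(insert e F, G) \<in> forest_poset n"
    using ex_forest_between by blast
  have "less_in (forest_poset n) F (insert e F)" using e by (auto simp: less_in_def)
  then have "G = insert e F" using c e(3) unfolding covers_def less_in_def by blast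
  moreover have "finite F" using FG finite_rooted_forest by (auto simp: forest_poset_iff)
  ultimately show "card G = Suc (card F)" using e(1) by simp
qed simp

lemma graded_poset_forest_poset: "graded_poset (forest_poset n)"
  unfolding graded_poset_def
  using finite_forest_poset Partial_order_forest_poset is_bottom_forest_poset is_rank_function_forest_poset
  by blast

subsection \<open>The Moebius function of the forest poset\<close>

definition toggle :: "'a \<Rightarrow> 'a set \<Rightarrow> 'a set" where
  "toggle e F = (if e \<in> F then F - {e} else insert e F)"

lemma toggle_toggle: "toggle e (toggle e F) = F"
  by (auto simp: toggle_def)

text \<open>A sign-reversing involution. The third premise says that the toggled element is chosen
  alike before and after, so toggling twice is the identity; the sum then equals its own
  negative.\<close>

lemma sum_card_toggle_eq_0:
  assumes "\<And>F. F \<in> S \<Longrightarrow> finite F"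
    and "\<And>F. F \<in> S \<Longrightarrow> toggle (t F) F \<in> S"
    and "\<And>F. F \<in> S \<Longrightarrow> t (toggle (t F) F) = t F"
  shows "(\<Sum>F\<in>S. (- 1) ^ card F :: int) = 0"
proof -
  have "(\<Sum>F\<in>S. (- 1) ^ card F :: int) = (\<Sum>F\<in>S. - ((- 1) ^ card F))"
  proof (rule sum.reindex_bij_witness[where i = "\<lambda>F. toggle (t F) F"
    and j = "\<lambda>F. toggle (t F) F"])
    fix F assume F: "F \<in> S"
    show "- ((- 1) ^ card (toggle (t F) F)) = ((- 1) ^ card F :: int)"
    proof (cases "t F \<in> F")
      case True
      have c: "card F = Suc (card (F - {t F}))" by (rule card.remove[OF assms(1)[OF F] True])
      have "(- 1) ^ card F = - ((- 1) ^ card (F - {t F}) :: int)" unfolding c by simp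
      then show ?thesis using True unfolding toggle_def by simp
    next
      case False
      then show ?thesis using assms(1)[OF F] by (simp add: toggle_def)
    qed
  qed (simp_all add: assms toggle_toggle)
  then show ?thesis by (simp add: sum_negf)
qed

text \<open>If \<open>v\<close> has a child in \<open>G\<close> and an edge of \<open>F\<close>
  leaves \<open>v\<close>, the ideal condition puts the child's edge into \<open>F\<close> as well,
  so \<open>F\<close> is no star forest. Edges that leave leaves can be kept in any combination: the
  star forests below \<open>G\<close> form a Boolean lattice.\<close>

lemma forest_below_star_iff:
  assumes G: "rooted_forest n G"
  shows "(F, G) \<in> forest_poset n \<and> Domain F \<inter> Range F = {} \<longleftrightarrow> F \<subseteq> {e \<in> G. fst e \<notin> Range G}"
proof
  assume F: "(F, G) \<in> forest_poset n \<and> Domain F \<inter> Range F = {}"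
  show "F \<subseteq> {e \<in> G. fst e \<notin> Range G}"
  proof
    fix e assume e: "e \<in> F"
    obtain v w where vw: "e = (v, w)" by (cases e)
    have "v \<notin> Range G"
    proof
      assume "v \<in> Range G"
      then obtain y where "(y, v) \<in> G" by blast
      then have "(y, v) \<in> F" using F e vw by (auto simp: forest_poset_iff)
      then show False using F e vw by blast
    qed
    then show "e \<in> {e \<in> G. fst e \<notin> Range G}" using F e vw by (auto simp: forest_poset_iff)
  qed
next
  assume F: "F \<subseteq> {e \<in> G. fst e \<notin> Range G}"
  then have "F \<subseteq> G" by blast
  moreover have "rooted_forest n F" using rooted_forest_subset[OF G \<open>F \<subseteq> G\<close>] .
  moreover have "w \<notin> Domain F" if "(v, w) \<in> G" for v w using that F by force
  ultimately show "(F, G) \<in> forest_poset n \<and> Domain F \<inter> Range F = {}"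
    using G by (auto simp: forest_poset_iff)
qed

text \<open>Only star forests contribute to the sum over a lower set, and they are the subsets of
  the set of leaf edges. A nonempty \<open>G\<close> has such an edge, so the alternating sum
  vanishes.\<close>

lemma moebius_forest_poset:
  assumes "rooted_forest n G"
  shows "moebius (forest_poset n) {} G = (if Domain G \<inter> Range G = {} then (- 1) ^ card G else 0)"
proof (rule moebius_eqI[OF finite_forest_poset Partial_order_forest_poset is_bottom_forest_poset])
  show "G \<in> Field (forest_poset n)" using assms by (simp add: Field_forest_poset)
  fix G assume "G \<in> Field (forest_poset n)" and ne: "G \<noteq> {}"
  then have G: "rooted_forest n G" by (simp add: Field_forest_poset)
  let ?L = "{e \<in> G. fst e \<notin> Range G}"
  have finL: "finite ?L" using finite_rooted_forest[OF G] by simp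
  have "wf G" using finite_acyclic_wf[OF finite_rooted_forest[OF G]] G by (simp add: rooted_forest_def)
  moreover obtain v0 where "v0 \<in> Domain G" using ne by auto
  ultimately obtain v where v: "v \<in> Domain G"
    and min: "\<And>y. (y, v) \<in> G \<Longrightarrow> y \<notin> Domain G"
    using wfE_min by metis
  then obtain w where "(v, w) \<in> G" by blast
  moreover have "v \<notin> Range G" using min by blast
  ultimately have e: "(v, w) \<in> ?L" by simp
  have fin: "finite {F. (F, G) \<in> forest_poset n}" by (rule finite_lower_set[OF finite_forest_poset])
  have "(\<Sum>F\<in>{F. (F, G) \<in> forest_poset n}. if Domain F \<inter> Range F = {} then (- 1) ^ card F else 0)
      = (\<Sum>F\<in>{F \<in> {F. (F, G) \<in> forest_poset n}. Domain F \<inter> Range F = {}}. (- 1) ^ card F :: int)"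
    using fin by (rule sum.inter_filter[symmetric])
  also have "{F \<in> {F. (F, G) \<in> forest_poset n}. Domain F \<inter> Range F = {}} = Pow ?L"
    by (rule set_eqI) (simp only: mem_Collect_eq Pow_iff forest_below_star_iff[OF G])
  also have "(\<Sum>F\<in>Pow ?L. (- 1) ^ card F :: int) = 0"
  proof (rule sum_card_toggle_eq_0[where t = "\<lambda>_. (v, w)"])
    show "finite F" if "F \<in> Pow ?L" for F using that finL finite_subset by blast
    show "toggle (v, w) F \<in> Pow ?L" if "F \<in> Pow ?L" for F
      using that e unfolding toggle_def by (auto split: if_splits)
  qed simp
  finally show "(\<Sum>F\<in>{F. (F, G) \<in> forest_poset n}. if Domain F \<inter> Range F = {} then (- 1) ^ card F else 0)
      = (0 :: int)" .
qed simp

subsection \<open>The pointed partition of a forest\<close>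

definition tree_partition :: "nat \<Rightarrow> nat rel \<Rightarrow> pointed set" where
  "tree_partition n F = (\<lambda>r. ({v \<in> {1..n}. (v, r) \<in> F\<^sup>*}, r)) ` ({1..n} - Domain F)"

lemma in_tree_partition:
  "(A, r) \<in> tree_partition n F \<longleftrightarrow>
     r \<in> {1..n} \<and> r \<notin> Domain F \<and> A = {v \<in> {1..n}. (v, r) \<in> F\<^sup>*}"
  by (auto simp: tree_partition_def)

lemma ex_root:
  assumes F: "rooted_forest n F" and v: "v \<in> {1..n}"
  obtains r where "r \<in> {1..n}" "r \<notin> Domain F" "(v, r) \<in> F\<^sup>*"
proof -
  have "wf (F\<inverse>)"
    using finite_acyclic_wf_converse[OF finite_rooted_forest[OF F]] F by (simp add: rooted_forest_def)
  moreover have "v \<in> {w. (v, w) \<in> F\<^sup>*}" by simp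
  ultimately obtain r where r: "r \<in> {w. (v, w) \<in> F\<^sup>*}"
    and min: "\<And>y. (y, r) \<in> F\<inverse> \<Longrightarrow> y \<notin> {w. (v, w) \<in> F\<^sup>*}"
    using wfE_min by metis
  have vr: "(v, r) \<in> F\<^sup>*" using r by simp
  have "r \<notin> Domain F"
  proof
    assume "r \<in> Domain F"
    then obtain y where "(r, y) \<in> F" by blast
    then show False using min[of y] vr by (auto intro: rtrancl_into_rtrancl)
  qed
  moreover have "r \<in> {1..n}"
    using vr
  proof (cases rule: rtranclE)
    case base
    then show ?thesis using v by simp
  next
    case (step y)
    then show ?thesis using F unfolding rooted_forest_def by blast
  qed
  ultimately show thesis using that vr by blast
qed

text \<open>Parents are unique, so the ancestors of \<open>v\<close> form a chain, and a root can
  only be at its end.\<close>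

lemma root_unique:
  assumes "rooted_forest n F" "(v, r) \<in> F\<^sup>*" "(v, s) \<in> F\<^sup>*" "r \<notin> Domain F" "s \<notin> Domain F"
  shows "r = s"
proof -
  have "single_valued F" using assms(1) by (simp add: rooted_forest_def)
  then have "(r, s) \<in> F\<^sup>* \<or> (s, r) \<in> F\<^sup>*"
    using single_valued_confluent assms(2,3) by metis
  then show ?thesis using Not_Domain_rtrancl[OF assms(4)] Not_Domain_rtrancl[OF assms(5)] by auto
qed

lemma pointed_partition_tree_partition:
  assumes F: "rooted_forest n F"
  shows "pointed_partition n (tree_partition n F)"
proof (rule pointed_partitionI)
  fix A r assume "(A, r) \<in> tree_partition n F"
  then show "r \<in> A \<and> A \<subseteq> {1..n}" by (auto simp: in_tree_partition)
next
  fix i assume i: "i \<in> {1..n}"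
  then obtain r where "r \<in> {1..n}" "r \<notin> Domain F" "(i, r) \<in> F\<^sup>*"
    using ex_root[OF F] by blast
  then show "\<exists>A r. (A, r) \<in> tree_partition n F \<and> i \<in> A"
    unfolding in_tree_partition using i by blast
next
  fix A r B s i
  assume "(A, r) \<in> tree_partition n F" "(B, s) \<in> tree_partition n F" "i \<in> A" "i \<in> B"
  then show "A = B \<and> r = s"
    unfolding in_tree_partition using root_unique[OF F, of i r s] by blast
qed

text \<open>Every vertex that is not a root has exactly one edge to a parent, so the edges count the
  non-roots. This makes the passage from forests to partitions rank preserving.\<close>

lemma card_tree_partition:
  assumes F: "rooted_forest n F"
  shows "n - card (tree_partition n F) = card F"
proof -
  have "inj_on (\<lambda>r. ({v \<in> {1..n}. (v, r) \<in> F\<^sup>*}, r)) ({1..n} - Domain F)"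
    by (auto intro: inj_onI)
  then have "card (tree_partition n F) = card ({1..n} - Domain F)"
    unfolding tree_partition_def by (rule card_image)
  moreover have sub: "Domain F \<subseteq> {1..n}" using F by (auto simp: rooted_forest_def)
  moreover have "card ({1..n} - Domain F) = n - card (Domain F)"
    using card_Diff_subset[OF finite_subset[OF sub] sub] by simp
  moreover have "card (Domain F) \<le> n" using card_mono[OF _ sub] by simp
  moreover have "card (Domain F) = card F"
  proof -
    have "inj_on fst F" using F by (auto simp: rooted_forest_def intro!: inj_onI dest: single_valuedD)
    then show ?thesis using card_image[of fst F] by (simp add: Domain_fst)
  qed
  ultimately show ?thesis by simp
qed

text \<open>The condition that the trees of \<open>F\<close> lie below \<open>\<pi>\<close>, stated
  edge by edge, so that adding or removing one edge can be checked on that edge alone.\<close>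

definition compatible :: "nat rel \<Rightarrow> pointed set \<Rightarrow> bool" where
  "compatible F \<pi> \<longleftrightarrow> (\<forall>v w. (v, w) \<in> F \<longrightarrow> (\<exists>C s. (C, s) \<in> \<pi> \<and> v \<in> C \<and> w \<in> C \<and> v \<noteq> s))"

text \<open>A tree below \<open>\<pi>\<close> stays within one block, and the point of that block
  can occur in it only as its root, which no edge leaves. Conversely, paths of compatible edges stay
  in a block, and its point, having no outgoing edge, can only be the root of its tree.\<close>

lemma tree_partition_pointed_refines_iff:
  assumes F: "rooted_forest n F" and \<pi>: "pointed_partition n \<pi>"
  shows "pointed_refines (tree_partition n F) \<pi> \<longleftrightarrow> compatible F \<pi>"
proof
  assume co: "pointed_refines (tree_partition n F) \<pi>"
  show "compatible F \<pi>" unfolding compatible_def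
  proof (intro allI impI)
    fix v w assume vw: "(v, w) \<in> F"
    then have n: "v \<in> {1..n}" "w \<in> {1..n}" using F by (auto simp: rooted_forest_def)
    obtain C s where C: "(C, s) \<in> \<pi>" "v \<in> C" using ex_block[OF \<pi> n(1)] by blast
    obtain r where r: "r \<in> {1..n}" "r \<notin> Domain F" "(w, r) \<in> F\<^sup>*"
      using ex_root[OF F n(2)] by blast
    let ?A = "{v \<in> {1..n}. (v, r) \<in> F\<^sup>*}"
    have A: "(?A, r) \<in> tree_partition n F" using r by (simp add: in_tree_partition)
    have vwA: "v \<in> ?A" "w \<in> ?A" using n r(3) vw by (auto intro: converse_rtrancl_into_rtrancl)
    have "?A \<subseteq> C" "s \<in> ?A \<Longrightarrow> s = r"
      using pointed_refines_block[OF co \<pi> A C(1) vwA(1) C(2)] by blast+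
    moreover have "v \<noteq> r" using vw r(2) by blast
    ultimately have "w \<in> C" "v \<noteq> s" using vwA by blast+
    then show "\<exists>C s. (C, s) \<in> \<pi> \<and> v \<in> C \<and> w \<in> C \<and> v \<noteq> s" using C by blast
  qed
next
  assume comp: "compatible F \<pi>"
  show "pointed_refines (tree_partition n F) \<pi>" unfolding pointed_refines_def
  proof (rule ballI, rule case_prodI2)
    fix X A r assume "X \<in> tree_partition n F" "X = (A, r)"
    then have r: "r \<in> {1..n}" "r \<notin> Domain F"
      and A: "A = {v \<in> {1..n}. (v, r) \<in> F\<^sup>*}"
      by (simp_all add: in_tree_partition)
    obtain C s where C: "(C, s) \<in> \<pi>" "r \<in> C" using ex_block[OF \<pi> r(1)] by blast
    have "v \<in> C" if "(v, r) \<in> F\<^sup>*" for v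
      using that
    proof (induction rule: converse_rtrancl_induct)
      case (step y z)
      then obtain D t where "(D, t) \<in> \<pi>" "y \<in> D" "z \<in> D"
        using comp unfolding compatible_def by blast
      then show ?case using block_unique[OF \<pi> _ C(1), of D t z] step.IH by blast
    qed (rule C(2))
    then have "A \<subseteq> C" unfolding A by blast
    moreover have "s \<notin> Domain F"
    proof
      assume "s \<in> Domain F"
      then obtain D t where "(D, t) \<in> \<pi>" "s \<in> D" "s \<noteq> t"
        using comp unfolding compatible_def by blast
      then show False using block_unique[OF \<pi> _ C(1), of D t s] point_in_block[OF \<pi> C(1)] by blast
    qed
    then have "s \<in> A \<longrightarrow> s = r" unfolding A using Not_Domain_rtrancl[of s F r] by simp
    ultimately show "\<exists>(C, s)\<in>\<pi>. A \<subseteq> C \<and> (s \<in> A \<longrightarrow> s = r)" using C(1) by blast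
  qed
qed

text \<open>Going upwards inside \<open>C - {s}\<close> must stop, since the forest is finite and
  acyclic. Where it stops there is a root or, because edges do not leave \<open>C\<close>, a child
  of \<open>s\<close>.\<close>

lemma ex_toggle_vertex:
  assumes F: "rooted_forest n F" and comp: "compatible F \<pi>" and \<pi>: "pointed_partition n \<pi>"
    and C: "(C, s) \<in> \<pi>" and ne: "C \<noteq> {s}"
  shows "{v \<in> C - {s}. v \<notin> Domain F \<or> (v, s) \<in> F} \<noteq> {}"
proof -
  have "wf (F\<inverse>)"
    using finite_acyclic_wf_converse[OF finite_rooted_forest[OF F]] F by (simp add: rooted_forest_def)
  moreover obtain v0 where "v0 \<in> C - {s}" using ne point_in_block[OF \<pi> C] by blast
  ultimately obtain v where v: "v \<in> C - {s}"
    and min: "\<And>y. (y, v) \<in> F\<inverse> \<Longrightarrow> y \<notin> C - {s}"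
    using wfE_min by metis
  have "(v, s) \<in> F" if vD: "v \<in> Domain F"
  proof -
    obtain w where vw: "(v, w) \<in> F" using vD by blast
    then obtain D t where D: "(D, t) \<in> \<pi>" "v \<in> D" "w \<in> D"
      using comp unfolding compatible_def by blast
    then have "w \<in> C" using block_unique[OF \<pi> D(1) C, of v] v by blast
    moreover have "w \<notin> C - {s}" using min[of w] vw by simp
    ultimately show ?thesis using vw by blast
  qed
  then show ?thesis using v by blast
qed

text \<open>
  A non-root \<open>v\<close> of the block whose parent is the root \<open>s\<close>,
    and a root \<open>v \<noteq> s\<close>, are interchangeable:
  adding or removing the edge \<open>(v, s)\<close> creates no cycle.  Toggling this edge for the least such
  \<open>v\<close> is a sign reversing involution.
\<close>

lemma sum_compatible_forests:
  assumes \<pi>: "pointed_partition n \<pi>" and C: "(C, s) \<in> \<pi>" and ne: "C \<noteq> {s}"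
  shows "(\<Sum>F\<in>{F. rooted_forest n F \<and> compatible F \<pi>}. (- 1) ^ card F :: int) = 0"
proof (rule sum_card_toggle_eq_0)
  let ?V = "\<lambda>F. {v \<in> C - {s}. v \<notin> Domain F \<or> (v, s) \<in> F}"
  let ?t = "\<lambda>F. (Min (?V F), s)"
  fix F assume "F \<in> {F. rooted_forest n F \<and> compatible F \<pi>}"
  then have F: "rooted_forest n F" and comp: "compatible F \<pi>" by simp_all
  show "finite F" using F by (rule finite_rooted_forest)
  have "finite (?V F)" using finite_block[OF \<pi> C] by simp
  then have "Min (?V F) \<in> ?V F" using ex_toggle_vertex[OF F comp \<pi> C ne] by (rule Min_in)
  then obtain v where v: "Min (?V F) = v" "v \<in> C" "v \<noteq> s" "v \<notin> Domain F \<or> (v, s) \<in> F" by blast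
  have sC: "s \<in> C" using point_in_block[OF \<pi> C] .
  have n: "v \<in> {1..n}" "s \<in> {1..n}" using block_subset[OF \<pi> C] v(2) sC by blast+
  have sD: "s \<notin> Domain F"
  proof
    assume "s \<in> Domain F"
    then obtain D t where "(D, t) \<in> \<pi>" "s \<in> D" "s \<noteq> t"
      using comp unfolding compatible_def by blast
    then show False using block_unique[OF \<pi> _ C, of D t s] sC by blast
  qed
  have "rooted_forest n (toggle (v, s) F) \<and> compatible (toggle (v, s) F) \<pi>"
  proof (cases "(v, s) \<in> F")
    case True
    then show ?thesis
      using rooted_forest_subset[OF F, of "F - {(v, s)}"] comp by (auto simp: toggle_def compatible_def)
  next
    case False
    then have vD: "v \<notin> Domain F" using v(4) by blast
    have "(s, v) \<notin> F\<^sup>*" using Not_Domain_rtrancl[OF sD] v(3) by simp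
    moreover have "single_valued (insert (v, s) F)"
      using F vD by (auto simp: rooted_forest_def single_valued_def)
    ultimately have "rooted_forest n (insert (v, s) F)" using F n by (simp add: rooted_forest_def)
    moreover have "compatible (insert (v, s) F) \<pi>"
      using comp C v(2,3) sC unfolding compatible_def by blast
    ultimately show ?thesis using False by (simp add: toggle_def)
  qed
  then show "toggle (?t F) F \<in> {F. rooted_forest n F \<and> compatible F \<pi>}" using v(1) by simp
  \<comment> \<open>Toggling affects only the edge leaving \<open>v\<close>, and \<open>v\<close> is
    a candidate both as a root and as a child of \<open>s\<close>. So the least candidate is
    unchanged and the map is an involution.\<close>
  have "?V (toggle (v, s) F) = ?V F"
  proof (rule Collect_cong)
    fix u
    show "u \<in> C - {s} \<and> (u \<notin> Domain (toggle (v, s) F) \<or> (u, s) \<in> toggle (v, s) F) \<longleftrightarrow>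
        u \<in> C - {s} \<and> (u \<notin> Domain F \<or> (u, s) \<in> F)"
    proof (cases "u = v")
      case True
      have "v \<notin> Domain (F - {(v, s)})" if "(v, s) \<in> F"
        using F that by (auto simp: rooted_forest_def dest: single_valuedD)
      then show ?thesis using True v(4) by (auto simp: toggle_def)
    next
      case False
      then show ?thesis by (auto simp: toggle_def)
    qed
  qed
  then show "?t (toggle (?t F) F) = ?t F" using v(1) by simp
qed

lemma tree_partition_empty: "tree_partition n {} = singletons n"
  by (auto simp: tree_partition_def singletons_def)

text \<open>Forests with equal tree partition have equally many edges, so the formula is a signed
  count of forests. Its sum over a lower set collects exactly the compatible forests, which
  cancel.\<close>

lemma moebius_pointed_partition_poset:
  assumes "pointed_partition n x"
  shows "moebius (pointed_partition_poset n) (singletons n) x =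
    (- 1) ^ (n - card x) * int (card {F. rooted_forest n F \<and> tree_partition n F = x})"
proof (rule moebius_eqI[OF finite_pointed_partition_poset Partial_order_pointed_partition_poset is_bottom_singletons])
  let ?f = "\<lambda>x. (- 1) ^ (n - card x) * int (card {F. rooted_forest n F \<and> tree_partition n F = x})"
  show "x \<in> Field (pointed_partition_poset n)"
    using assms by (simp add: Field_pointed_partition_poset)
  have "{F. rooted_forest n F \<and> tree_partition n F = singletons n} = {{}}"
  proof (intro equalityI subsetI)
    fix F assume "F \<in> {F. rooted_forest n F \<and> tree_partition n F = singletons n}"
    then have "rooted_forest n F" "card F = 0"
      using card_tree_partition[of n F] by (simp_all add: card_singletons)
    then show "F \<in> {{}}" using finite_rooted_forest by auto
  qed (simp add: tree_partition_empty rooted_forest_empty)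
  then show "?f (singletons n) = 1" by (simp add: card_singletons)
  fix \<pi> assume "\<pi> \<in> Field (pointed_partition_poset n)" and ne: "\<pi> \<noteq> singletons n"
  then have \<pi>: "pointed_partition n \<pi>" by (simp add: Field_pointed_partition_poset)
  have sing: "pointed_partition n (singletons n)"
    using is_bottom_singletons[of n] by (simp add: is_bottom_def Field_pointed_partition_poset)
  \<comment> \<open>The involution needs a block with more than one element.\<close>
  have "\<not> \<pi> \<subseteq> singletons n"
    using pointed_partition_subset_eq[OF \<pi> sing] ne by blast
  then obtain C s where C: "(C, s) \<in> \<pi>" "(C, s) \<notin> singletons n" by auto
  have "s \<in> {1..n}" using point_in_block[OF \<pi> C(1)] block_subset[OF \<pi> C(1)] by blast
  then have "C \<noteq> {s}" using C(2) by (auto simp: singletons_def)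
  let ?S = "{F. rooted_forest n F \<and> compatible F \<pi>}"
  let ?T = "{w. (w, \<pi>) \<in> pointed_partition_poset n}"
  have S_iff: "F \<in> ?S \<longleftrightarrow> rooted_forest n F \<and> tree_partition n F \<in> ?T" for F
    using tree_partition_pointed_refines_iff[OF _ \<pi>] pointed_partition_tree_partition \<pi>
    by (auto simp: pointed_partition_poset_iff)
  have "(\<Sum>w\<in>?T. ?f w) = (\<Sum>w\<in>?T. \<Sum>F\<in>{F \<in> ?S. tree_partition n F = w}. (- 1) ^ card F)"
  proof (rule sum.cong[OF refl])
    fix w assume w: "w \<in> ?T"
    have "{F \<in> ?S. tree_partition n F = w} = {F. rooted_forest n F \<and> tree_partition n F = w}"
      using S_iff w by blast
    moreover have "(\<Sum>F\<in>{F. rooted_forest n F \<and> tree_partition n F = w}. (- 1) ^ card F) =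
        (\<Sum>F\<in>{F. rooted_forest n F \<and> tree_partition n F = w}. (- 1) ^ (n - card w) :: int)"
      by (rule sum.cong) (auto simp: card_tree_partition)
    ultimately show "?f w = (\<Sum>F\<in>{F \<in> ?S. tree_partition n F = w}. (- 1) ^ card F)" by simp
  qed
  also have "\<dots> = (\<Sum>F\<in>?S. (- 1) ^ card F)"
  proof (rule sum.group)
    show "finite ?S" by (rule finite_subset[OF _ finite_rooted_forests[of n]]) blast
    show "finite ?T" by (rule finite_lower_set[OF finite_pointed_partition_poset])
    show "tree_partition n ` ?S \<subseteq> ?T" using S_iff by blast
  qed
  also have "\<dots> = 0" using sum_compatible_forests[OF \<pi> C(1) \<open>C \<noteq> {s}\<close>] .
  finally show "(\<Sum>w\<in>?T. ?f w) = 0" .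
qed

subsection \<open>Star forests and pointed partitions\<close>

lemma star_rtrancl:
  assumes "Domain F \<inter> Range F = {}" "(v, w) \<in> F\<^sup>*"
  shows "v = w \<or> (v, w) \<in> F"
  using assms(2) by (induction rule: rtrancl_induct) (use assms(1) in blast)+

lemma star_acyclic:
  assumes "Domain F \<inter> Range F = {}"
  shows "acyclic F"
  unfolding acyclic_def
proof (intro allI notI)
  fix v assume "(v, v) \<in> F\<^sup>+"
  then obtain y z where "(v, y) \<in> F" "(z, v) \<in> F" by (meson tranclD tranclD2)
  then show False using assms by blast
qed

text \<open>The inverse hangs every other element of a block directly below its point; no point then
  has a parent, so the result has height at most one.\<close>

lemma bij_betw_tree_partition:
  "bij_betw (tree_partition n) {F. rooted_forest n F \<and> Domain F \<inter> Range F = {}} {x. pointed_partition n x}"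
proof (rule bij_betw_byWitness[where f' = "\<lambda>x. {(v, p). \<exists>A. (A, p) \<in> x \<and> v \<in> A \<and> v \<noteq> p}"])
  let ?star = "\<lambda>x. {(v, p). \<exists>A. (A, p) \<in> x \<and> v \<in> A \<and> v \<noteq> p}"
  let ?S = "{F. rooted_forest n F \<and> Domain F \<inter> Range F = {}}"
  show "\<forall>F\<in>?S. ?star (tree_partition n F) = F"
  proof
    fix F assume "F \<in> ?S"
    then have F: "rooted_forest n F" and st: "Domain F \<inter> Range F = {}" by simp_all
    have "(v, p) \<in> ?star (tree_partition n F) \<longleftrightarrow> (v, p) \<in> F" for v p
    proof
      assume "(v, p) \<in> ?star (tree_partition n F)"
      then show "(v, p) \<in> F" using star_rtrancl[OF st, of v p] by (auto simp: in_tree_partition)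
    next
      assume vp: "(v, p) \<in> F"
      then have "p \<notin> Domain F" "v \<noteq> p" using st by blast+
      moreover have "v \<in> {1..n}" "p \<in> {1..n}" using F vp by (auto simp: rooted_forest_def)
      ultimately show "(v, p) \<in> ?star (tree_partition n F)"
        using vp by (simp add: in_tree_partition)
    qed
    then show "?star (tree_partition n F) = F" by (simp add: set_eq_iff split_paired_all)
  qed
  have star: "rooted_forest n (?star x) \<and> Domain (?star x) \<inter> Range (?star x) = {}"
    if x: "pointed_partition n x" for x
  proof -
    have DR: "p \<notin> Domain (?star x)" if p: "(A, p) \<in> x" for A p
      using block_unique[OF x p _ point_in_block[OF x p]] by blast
    have st: "Domain (?star x) \<inter> Range (?star x) = {}" using DR by auto
    have "acyclic (?star x)" using st by (rule star_acyclic)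
    moreover have "?star x \<subseteq> {1..n} \<times> {1..n}"
      using block_subset[OF x] point_in_block[OF x] by blast
    moreover have "single_valued (?star x)"
    proof (rule single_valuedI)
      fix v p q assume "(v, p) \<in> ?star x" "(v, q) \<in> ?star x"
      then obtain A B where "(A, p) \<in> x" "v \<in> A" "(B, q) \<in> x" "v \<in> B" by blast
      then show "p = q" using block_unique[OF x, of A p B q v] by blast
    qed
    ultimately show ?thesis using st by (simp only: rooted_forest_def simp_thms)
  qed
  then show "?star ` {x. pointed_partition n x} \<subseteq> ?S" by blast
  show "tree_partition n ` ?S \<subseteq> {x. pointed_partition n x}"
    using pointed_partition_tree_partition by blast
  show "\<forall>x\<in>{x. pointed_partition n x}. tree_partition n (?star x) = x"
  proof
    fix x assume "x \<in> {x. pointed_partition n x}"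
    then have x: "pointed_partition n x" by simp
    have F: "rooted_forest n (?star x)" and st: "Domain (?star x) \<inter> Range (?star x) = {}"
      using star[OF x] by blast+
    \<comment> \<open>One inclusion suffices, as both sides are pointed partitions of the same
      set.\<close>
    have "x \<subseteq> tree_partition n (?star x)"
    proof
      fix X assume X: "X \<in> x"
      obtain A p where Ap: "X = (A, p)" by (cases X)
      then have A: "(A, p) \<in> x" using X by simp
      have p: "p \<in> A" using point_in_block[OF x A] .
      have An: "A \<subseteq> {1..n}" using block_subset[OF x A] .
      have pD: "p \<notin> Domain (?star x)" using block_unique[OF x A _ p] by blast
      have "(v, p) \<in> (?star x)\<^sup>*" if "v \<in> A" for v
      proof (cases "v = p")
        case False
        then have "(v, p) \<in> ?star x" using A that by blast
        then show ?thesis by (rule r_into_rtrancl)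
      qed simp
      moreover have "v \<in> A" if "(v, p) \<in> (?star x)\<^sup>*" for v
        using star_rtrancl[OF st that] p block_unique[OF x A _ p] point_in_block[OF x] by blast
      ultimately have "A = {v \<in> {1..n}. (v, p) \<in> (?star x)\<^sup>*}" using An by blast
      then have "(A, p) \<in> tree_partition n (?star x)" unfolding in_tree_partition
        using p An pD by blast
      then show "X \<in> tree_partition n (?star x)" using Ap by simp
    qed
    then show "tree_partition n (?star x) = x"
      using pointed_partition_subset_eq[OF x pointed_partition_tree_partition[OF F]] by simp
  qed
qed

section \<open>Comparison of the Whitney numbers\<close>

lemma rank_pointed_partition_poset:
  assumes "pointed_partition n x"
  shows "rank (pointed_partition_poset n) x = n - card x"
  using rank_eqI[OF finite_pointed_partition_poset Partial_order_pointed_partition_poset is_bottom_singletons is_rank_function_pointed_partition_poset] assms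
  by (simp add: Field_pointed_partition_poset)

lemma rank_forest_poset:
  assumes "rooted_forest n F"
  shows "rank (forest_poset n) F = card F"
  using rank_eqI[OF finite_forest_poset Partial_order_forest_poset is_bottom_forest_poset
      is_rank_function_forest_poset] assms
  by (simp add: Field_forest_poset)

text \<open>On a level all nonzero Moebius values have the same sign, so absolute values turn the
  sums into counts: forests with \<open>k\<close> edges, grouped by their tree partitions, and star
  forests with \<open>k\<close> edges, matched with the pointed partitions of rank
  \<open>k\<close>.\<close>

lemma whitney_duals_forest_poset: "whitney_duals (pointed_partition_poset n) (forest_poset n)"
  unfolding whitney_duals_def
proof (intro conjI allI)
  show "graded_poset (pointed_partition_poset n)" by (rule graded_pointed_partition_poset)
  show "graded_poset (forest_poset n)" by (rule graded_poset_forest_poset)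
  fix k
  have botP: "bottom (pointed_partition_poset n) = singletons n"
    by (rule bottom_eqI[OF Partial_order_pointed_partition_poset is_bottom_singletons])
  have botQ: "bottom (forest_poset n) = {}"
    by (rule bottom_eqI[OF Partial_order_forest_poset is_bottom_forest_poset])
  let ?P = "{x \<in> Field (pointed_partition_poset n). rank (pointed_partition_poset n) x = k}"
  let ?Q = "{F \<in> Field (forest_poset n). rank (forest_poset n) F = k}"
  have P: "?P = {x. pointed_partition n x \<and> n - card x = k}"
    using rank_pointed_partition_poset by (auto simp: Field_pointed_partition_poset)
  have Q: "?Q = {F. rooted_forest n F \<and> card F = k}"
    using rank_forest_poset by (auto simp: Field_forest_poset)
  have finP: "finite ?P"
    using finite_pointed_partitions[of n] by (simp add: Field_pointed_partition_poset)
  have finQ: "finite ?Q" using finite_rooted_forests[of n] by (simp add: Field_forest_poset)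
  have "whitney_first (pointed_partition_poset n) k =
      (\<Sum>x\<in>?P. \<Sum>F\<in>{F \<in> ?Q. tree_partition n F = x}. (- 1) ^ k)"
    unfolding whitney_first_def botP
  proof (rule sum.cong[OF refl])
    fix x assume "x \<in> ?P"
    then have x: "pointed_partition n x" "n - card x = k" unfolding P by simp_all
    have "{F \<in> ?Q. tree_partition n F = x} = {F. rooted_forest n F \<and> tree_partition n F = x}"
      unfolding Q using x(2) card_tree_partition by auto
    then show "moebius (pointed_partition_poset n) (singletons n) x =
        (\<Sum>F\<in>{F \<in> ?Q. tree_partition n F = x}. (- 1) ^ k)"
      using moebius_pointed_partition_poset[OF x(1)] x(2) by simp
  qed
  also have "\<dots> = (\<Sum>F\<in>?Q. (- 1) ^ k)"
  proof (rule sum.group[OF finQ finP])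
    show "tree_partition n ` ?Q \<subseteq> ?P"
      unfolding P Q using card_tree_partition pointed_partition_tree_partition by auto
  qed
  finally show "\<bar>whitney_first (pointed_partition_poset n) k\<bar> = int (whitney_second (forest_poset n) k)"
    by (simp add: whitney_second_def abs_mult power_abs)
  let ?S = "{F. rooted_forest n F \<and> Domain F \<inter> Range F = {}}"
  have "whitney_first (forest_poset n) k =
      (\<Sum>F\<in>?Q. if Domain F \<inter> Range F = {} then (- 1) ^ k else 0)"
    unfolding whitney_first_def botQ
    by (rule sum.cong[OF refl], unfold Q) (simp add: moebius_forest_poset)
  also have "\<dots> = (\<Sum>F\<in>{F \<in> ?Q. Domain F \<inter> Range F = {}}. (- 1) ^ k)"
    using finQ by (rule sum.inter_filter[symmetric])
  finally have "\<bar>whitney_first (forest_poset n) k\<bar> = int (card {F \<in> ?Q. Domain F \<inter> Range F = {}})"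
    by (simp add: abs_mult power_abs)
  also have "card {F \<in> ?Q. Domain F \<inter> Range F = {}} = card ?P"
  proof (rule bij_betw_same_card)
    have "{F \<in> ?Q. Domain F \<inter> Range F = {}} = {F \<in> ?S. card F = k}" unfolding Q by blast
    \<comment> \<open>The global bijection restricts to each level because the number of edges is
      the rank of the tree partition.\<close>
    moreover have "bij_betw (tree_partition n) {F \<in> ?S. card F = k} {x. pointed_partition n x \<and> n - card x = k}"
    proof (rule bij_betw_subset[OF bij_betw_tree_partition])
      show "tree_partition n ` {F \<in> ?S. card F = k} = {x. pointed_partition n x \<and> n - card x = k}"
      proof (intro equalityI subsetI)
        fix x assume "x \<in> {x. pointed_partition n x \<and> n - card x = k}"
        then have x: "pointed_partition n x" "n - card x = k" by simp_all
        then have "x \<in> tree_partition n ` ?S"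
          using bij_betw_imp_surj_on[OF bij_betw_tree_partition[of n]] by simp
        then obtain F where F: "F \<in> ?S" "x = tree_partition n F" by blast
        then have "card F = k" using card_tree_partition[of n F] x(2) by simp
        then show "x \<in> tree_partition n ` {F \<in> ?S. card F = k}" using F by blast
      qed (auto simp: card_tree_partition pointed_partition_tree_partition)
    qed blast
    ultimately show "bij_betw (tree_partition n) {F \<in> ?Q. Domain F \<inter> Range F = {}} ?P"
      unfolding P by simp
  qed
  finally show "\<bar>whitney_first (forest_poset n) k\<bar> = int (whitney_second (pointed_partition_poset n) k)"
    by (simp add: whitney_second_def)
qed

theorem theorem2p13:
  fixes n :: nat
  assumes "n \<ge> 1"
  shows "EW_labeling (pointed_partition_poset n) (label_poset n) lambda_bullet \<and>
         has_whitney_dual (pointed_partition_poset n)"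
  using EW_labeling_lambda_bullet[OF assms] has_whitney_dualI[OF whitney_duals_forest_poset] by blast

end
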